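(* For every integer $k\ge 0$ there exists a constant $0<c_k<1$, depending only on $k$, such that the following holds. Let $\{A_n\}_{n=1}^{\infty}$ be $\mathbb{N}$-valued random variables on a common probability space. Assume that $\{A_n\}_{n=1}^{\infty}$ is a $k$-step Markov chain (when $k=0$ this means that $A_1,A_2,\ldots$ are independent) and that it is $*$-mixing. Let $\nu$ be the distribution of the random variable $[A_1,A_2,\ldots]$. Then $\dim_H(\nu)\le 1-c_k$.
   Context: $\mathbb{N}=\{1,2,\ldots\}$ and $X=(0,1)\setminus\mathbb{Q}$. For $a_1,a_2,\ldots\in\mathbb{N}$, $[a_1,a_2,\ldots]$ denotes the unique $x\in X$ whose (regular) continued fraction expansion is $x=\frac{1}{a_1+\frac{1}{a_2+\frac{1}{a_3+\cdots}}}$. A sequence of discrete random variables $\{A_n\}_{n\ge1}$ is a $k$-step Markov chain if for every $n\ge k$ the conditional distribution of $A_{n+1}$ given $A_1,\ldots,A_n$ equals its conditional distribution given $A_{n-k+1},\ldots,A_n$ only (for $k=0$: independence). Neither stationarity nor time-homogeneity of the transition probabilities is assumed. For random variables $\{A_i\}_{i\in I}$, $\sigma\{A_i\}_{i\in I}$ is the smallest $\sigma$-algebra making all $A_i$ measurable. A sequence $\{A_n\}_{n=1}^\infty$ is $*$-mixing if there exist an integer $N\ge1$ and a real valued function $g$ on the integers $n\ge N$ such that $g$ is non-increasing with $\lim_n g(n)=0$, and for all $n\ge N$, $m\ge1$, $E\in\sigma\{A_1,\ldots,A_m\}$ and $F\in\sigma\{A_{m+n},A_{m+n+1},\ldots\}$,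 $|\mathbb{P}(E\cap F)-\mathbb{P}(E)\mathbb{P}(F)|\le g(n)\mathbb{P}(E)\mathbb{P}(F)$. For $E\subset X$, $\dim_H(E)$ is its Hausdorff dimension. For a Borel probability measure $\nu$ on $X$, $\dim_H(\nu)=\inf\{\dim_H(E): E\subset X \text{ Borel},\ \nu(E)=1\}$. *)

theory Defs
  imports "HOL-Probability.Probability"
begin

text \<open>
  Sequences indexed by \<open>{1, 2, \<dots>}\<close> are functions on \<^typ>\<open>nat\<close> whose value at \<open>0\<close> is
  never used.
\<close>

section \<open>Continued fractions\<close>

definition unit_irrationals :: "real set" where
  "unit_irrationals = {0<..<1} - \<rat>"

text \<open>\<open>cf_approximant n a = 1 / (a 1 + 1 / (a 2 + \<dots> + 1 / a n))\<close>, and \<open>0\<close> if \<open>n = 0\<close>.\<close>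

fun cf_approximant :: "nat \<Rightarrow> (nat \<Rightarrow> nat) \<Rightarrow> real" where
  "cf_approximant 0 a = 0"
| "cf_approximant (Suc n) a = 1 / (real (a 1) + cf_approximant n (\<lambda>i. a (Suc i)))"

definition continued_fraction :: "(nat \<Rightarrow> nat) \<Rightarrow> real" where
  "continued_fraction a =
     (THE x. x \<in> unit_irrationals \<and> (\<lambda>n. cf_approximant n a) \<longlonglongrightarrow> x)"


section \<open>Hausdorff dimension\<close>

text \<open>
  The exponent \<open>s\<close> is meant to be positive: as \<open>0 powr 0 = 0\<close>, the case \<open>s = 0\<close> is not counting
  measure. Boundedness is required separately in the covers because \<^const>\<open>diameter\<close> is
  real-valued and has no meaningful value on unbounded sets.
\<close>

definition hausdorff_premeasure :: "real \<Rightarrow> real \<Rightarrow> 'a::metric_space set \<Rightarrow> ennreal" where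
  "hausdorff_premeasure s \<delta> E =
     (INF U \<in> {U :: nat \<Rightarrow> 'a set. E \<subseteq> (\<Union>i. U i) \<and> (\<forall>i. bounded (U i) \<and> diameter (U i) \<le> \<delta>)}.
        \<Sum>i. ennreal (diameter (U i) powr s))"

definition hausdorff_measure :: "real \<Rightarrow> 'a::metric_space set \<Rightarrow> ennreal" where
  "hausdorff_measure s E = (SUP \<delta> \<in> {0<..}. hausdorff_premeasure s \<delta> E)"

definition hausdorff_dim :: "'a::metric_space set \<Rightarrow> ereal" where
  "hausdorff_dim E = Inf {ereal s | s. 0 < s \<and> hausdorff_measure s E = 0}"

definition measure_hausdorff_dim :: "'a::metric_space measure \<Rightarrow> ereal" where
  "measure_hausdorff_dim \<nu> = Inf {hausdorff_dim E | E. E \<in> sets \<nu> \<and> emeasure \<nu> E = 1}"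


section \<open>Markov chains and mixing\<close>

text \<open>
  For \<open>k = 0\<close> the window \<open>{n + 1 - k..n}\<close> is empty, so the right-hand side is the unconditional
  probability of \<open>A (n + 1) = b\<close>.
\<close>

definition markov_chain_of_order :: "nat \<Rightarrow> 'a measure \<Rightarrow> (nat \<Rightarrow> 'a \<Rightarrow> nat) \<Rightarrow> bool" where
  "markov_chain_of_order k M A \<longleftrightarrow>
     (\<forall>n\<ge>k. \<forall>a b.
        \<P>(\<omega> in M. \<forall>i\<in>{1..n}. A i \<omega> = a i) > 0 \<longrightarrow>
        \<P>(\<omega> in M. A (n + 1) \<omega> = b \<bar> \<forall>i\<in>{1..n}. A i \<omega> = a i) =
        \<P>(\<omega> in M. A (n + 1) \<omega> = b \<bar> \<forall>i\<in>{n + 1 - k..n}. A i \<omega> = a i))"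

definition generated_sigma :: "'a measure \<Rightarrow> (nat \<Rightarrow> 'a \<Rightarrow> nat) \<Rightarrow> nat set \<Rightarrow> 'a set set" where
  "generated_sigma M A I = sigma_sets (space M) (\<Union>i\<in>I. {A i -` B \<inter> space M | B. True})"

definition star_mixing :: "'a measure \<Rightarrow> (nat \<Rightarrow> 'a \<Rightarrow> nat) \<Rightarrow> bool" where
  "star_mixing M A \<longleftrightarrow>
     (\<exists>N\<ge>1. \<exists>g :: nat \<Rightarrow> real. antimono_on {N..} g \<and> g \<longlonglongrightarrow> 0 \<and>
        (\<forall>n\<ge>N. \<forall>m\<ge>1. \<forall>E \<in> generated_sigma M A {1..m}. \<forall>F \<in> generated_sigma M A {m + n..}.
           \<bar>measure M (E \<inter> F) - measure M E * measure M F\<bar> \<le> g n * measure M E * measure M F))"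


section \<open>The distribution of a random continued fraction\<close>

definition cf_distribution :: "'a measure \<Rightarrow> (nat \<Rightarrow> 'a \<Rightarrow> nat) \<Rightarrow> real measure" where
  "cf_distribution M A =
     distr M (restrict_space borel unit_irrationals) (\<lambda>\<omega>. continued_fraction (\<lambda>n. A n \<omega>))"

text \<open>
  HOL cannot quantify over types inside a formula, so in
  \<open>\<exists>c. \<dots> (\<forall>M :: 'a measure. \<dots>)\<close> the constant \<open>c\<close> might depend on the type \<^typ>\<open>'a\<close> of the sample
  points. To state that it depends on the order of the chain only, the theorem asserts the
  existence of \<open>c\<close> for the one closed type \<^typ>\<open>nat \<Rightarrow> nat\<close> and, as a second conjunct, that
  any such \<open>c\<close> is valid for probability spaces on every type \<^typ>\<open>'a\<close>.
\<close>

end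

theory Submission
  imports Defs
begin

text \<open>
  Write \<open>|w|\<close> for the length of the interval of points whose continued fraction starts with the
  digits of the word \<open>w\<close>, and \<open>\<nu>(w)\<close> for the probability that the chain starts with \<open>w\<close>. The
  dimension of \<open>\<nu>\<close> drops below \<open>1\<close> because a chain of order \<open>k\<close> and Lebesgue measure cannot agree
  on blocks of \<open>k + 2\<close> digits. Fix the past and let the \<open>k\<close> inner digits of a block be \<open>1\<close>. Under
  the chain, the first and the last digit of the block are then independent
  (\<open>prob_probe_factorizes\<close>). Under Lebesgue measure they are not: the first digit influences the law
  of the last one by an amount that is bounded below uniformly in the past
  (\<open>cyl_length_probe_det\<close>). Consequently the sum of \<open>\<surd>(|u| \<nu>(u))\<close> over all blocks \<open>u\<close>, with both
  quantities conditioned on the past, is at most \<open>1 - \<epsilon>\<close>, where \<open>\<epsilon> > 0\<close> depends only on \<open>k\<close>.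

  Large digits are so rare under Lebesgue measure that the sum of \<open>|u|\<^bsup>s\<^esup>\<close> converges for some
  \<open>s < 1\<close>. Hence the same holds with \<open>|u|\<close> replaced by \<open>|u|\<^bsup>1-c\<^esup>\<close> for some small \<open>c\<close> depending
  only on \<open>k\<close> (\<open>word_sum_cyl_length_powr\<close>, \<open>block_affinity_bound\<close>). Multiplying over consecutive blocks, the sum
  of \<open>\<surd>(|w|\<^bsup>1-c\<^esup> \<nu>(w))\<close> over words \<open>w\<close> of \<open>n\<close> blocks decays exponentially in \<open>n\<close>
  (\<open>affinity_decay\<close>). Outside an event of exponentially small probability, \<open>|w|\<^bsup>1-c\<^esup>\<close> is therefore
  smaller than \<open>\<nu>(w)\<close> by an exponential factor, and the intervals of the words \<open>w\<close> with this
  property have a summable total cost in dimension \<open>1 - c\<close>. By the Borel--Cantelli lemma, \<open>\<nu>\<close> is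
  carried by the set of points in infinitely many of these intervals, which has
  \<open>(1 - c)\<close>-dimensional Hausdorff measure \<open>0\<close> (\<open>dimension_le\<close>).

  For the independence of \<open>c\<close> from the sample space, a process on any space is replaced by the
  coordinate process on the space of digit sequences, which keeps the Markov property, the mixing
  property and the distribution of the continued fraction.
\<close>

section \<open>Continued fraction cylinders\<close>

text \<open>
  Digits are shifted by one: the letter \<open>d\<close> of a word stands for the partial quotient \<open>d + 1\<close>, so
  that every list of natural numbers is a word and no positivity side conditions arise in sums.

  If the last two convergents of a word \<open>v\<close> have denominators \<open>q'\<close>, \<open>q\<close> and \<open>t = q' / q\<close>, then the tail of a
  Lebesgue-random point of the cylinder of \<open>v\<close> has density \<open>(1 + t) / (1 + t x)\<^sup>2\<close> on \<open>[0, 1]\<close>.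
  Hence \<open>digit_prob t d\<close> is the conditional probability that the next letter is \<open>d\<close>, and the
  parameter \<open>t\<close> then moves to \<open>1 / (d + 1 + t)\<close>. Starting from \<open>t = 0\<close>, the resulting product is
  the length of the cylinder.
\<close>

definition digit_prob :: "real \<Rightarrow> nat \<Rightarrow> real" where
  "digit_prob t d = (1 + t) / ((real d + 1 + t) * (real d + 2 + t))"

fun cyl_length :: "real \<Rightarrow> nat list \<Rightarrow> real" where
  "cyl_length t [] = 1"
| "cyl_length t (d # w) = digit_prob t d * cyl_length (1 / (real d + 1 + t)) w"

fun cyl_param :: "real \<Rightarrow> nat list \<Rightarrow> real" where
  "cyl_param t [] = t"
| "cyl_param t (d # w) = cyl_param (1 / (real d + 1 + t)) w"

fun cf_interval :: "nat list \<Rightarrow> real set" where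
  "cf_interval [] = {0..1}"
| "cf_interval (d # w) = (\<lambda>x. 1 / (real d + 1 + x)) ` cf_interval w"

definition digit_word :: "(nat \<Rightarrow> nat) \<Rightarrow> nat \<Rightarrow> nat list" where
  "digit_word a n = map (\<lambda>i. a (Suc i) - 1) [0..<n]"

lemma cyl_length_append:
  "cyl_length t (w @ u) = cyl_length t w * cyl_length (cyl_param t w) u"
  by (induction w arbitrary: t) auto

lemma next_param_bounds: "0 \<le> t \<Longrightarrow> 0 \<le> 1 / (real d + 1 + t) \<and> 1 / (real d + 1 + t) \<le> 1"
  by (auto simp: divide_simps)

lemma cyl_param_bounds: "0 \<le> t \<Longrightarrow> t \<le> 1 \<Longrightarrow> 0 \<le> cyl_param t w \<and> cyl_param t w \<le> 1"
  by (induction w arbitrary: t) (auto simp: next_param_bounds)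

lemma digit_prob_pos: "0 \<le> t \<Longrightarrow> 0 < digit_prob t d"
  by (auto simp: digit_prob_def intro!: divide_pos_pos mult_pos_pos)

lemma digit_prob_le_half:
  assumes "0 \<le> t" shows "digit_prob t d \<le> 1 / 2"
proof -
  have "(1 + t) * 2 \<le> (1 + t) * (real d + 2 + t)"
    using assms by (intro mult_left_mono) auto
  also have "\<dots> \<le> (real d + 1 + t) * (real d + 2 + t)"
    using assms by (intro mult_right_mono) auto
  finally show ?thesis
    using assms by (simp add: digit_prob_def divide_simps)
qed

lemma cyl_length_pos: "0 \<le> t \<Longrightarrow> 0 < cyl_length t w"
  by (induction w arbitrary: t) (auto intro!: mult_pos_pos digit_prob_pos simp: next_param_bounds)

lemma cyl_length_le: "0 \<le> t \<Longrightarrow> cyl_length t w \<le> (1 / 2) ^ length w"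
proof (induction w arbitrary: t)
  case (Cons d w)
  have "digit_prob t d * cyl_length (1 / (real d + 1 + t)) w \<le> 1 / 2 * (1 / 2) ^ length w"
    using Cons next_param_bounds[of t d] cyl_length_pos[of "1 / (real d + 1 + t)" w]
    by (intro mult_mono digit_prob_le_half) auto
  then show ?case by simp
qed simp

lemma cyl_length_le_1: "0 \<le> t \<Longrightarrow> cyl_length t w \<le> 1"
  by (rule order_trans[OF cyl_length_le]) (auto simp: power_le_one)

lemma cf_interval_subset: "cf_interval w \<subseteq> {0..1}"
proof (induction w)
  case (Cons d w)
  then show ?case by (force simp: divide_simps)
qed simp

lemma compact_cf_interval: "compact (cf_interval w)"
proof (induction w)
  case (Cons d w)
  have "continuous_on (cf_interval w) (\<lambda>x. 1 / (real d + 1 + x))"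
    using cf_interval_subset[of w] by (intro continuous_intros) (force simp: add_nonneg_eq_0_iff)
  then show ?case using Cons by (simp add: compact_continuous_image)
qed simp

text \<open>
  The function \<open>F\<^sub>t x = (1 + t) x / (1 + t x)\<close> is the distribution function of the density
  \<open>(1 + t) / (1 + t x)\<^sup>2\<close>. The inverse branch \<open>x \<mapsto> 1 / (d + 1 + x)\<close> carries the density with
  parameter \<open>1 / (d + 1 + t)\<close> to the one with parameter \<open>t\<close>, up to the factor \<open>digit_prob t d\<close>;
  this makes the induction exact. For \<open>t = 0\<close> the function is the identity.
\<close>

lemma cf_interval_distortion:
  assumes "0 \<le> t" "x \<in> cf_interval w" "y \<in> cf_interval w"
  shows "\<bar>(1 + t) * x / (1 + t * x) - (1 + t) * y / (1 + t * y)\<bar> \<le> cyl_length t w"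
  using assms
proof (induction w arbitrary: t x y)
  case Nil
  have range: "0 \<le> (1 + t) * z / (1 + t * z) \<and> (1 + t) * z / (1 + t * z) \<le> 1" if "z \<in> {0..1}" for z
    using that Nil.prems(1) by (auto simp: divide_simps add_pos_nonneg algebra_simps)
  have "x \<in> {0..1}" "y \<in> {0..1}" using Nil.prems by auto
  from range[OF this(1)] range[OF this(2)] show ?case
    unfolding abs_le_iff cyl_length.simps by linarith
next
  case (Cons d w)
  obtain x' y' where x': "x' \<in> cf_interval w" "x = 1 / (real d + 1 + x')"
    and y': "y' \<in> cf_interval w" "y = 1 / (real d + 1 + y')"
    using Cons.prems by auto
  define T where "T = 1 / (real d + 1 + t)"
  have T: "0 < T" using Cons.prems by (auto simp: T_def)
  have nn: "0 \<le> x'" "0 \<le> y'" using x' y' cf_interval_subset[of w] by auto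
  have img: "(1 + t) * (1 / (real d + 1 + z)) / (1 + t * (1 / (real d + 1 + z))) = (1 + t) * T / (1 + T * z)"
    if "0 \<le> z" for z
  proof -
    have pos: "0 < real d + 1 + z" "0 < real d + 1 + t" "0 < real d + 1 + t + z"
      using that Cons.prems(1) by auto
    have "1 + t * (1 / (real d + 1 + z)) = (real d + 1 + t + z) / (real d + 1 + z)"
      "1 + T * z = (real d + 1 + t + z) / (real d + 1 + t)"
      using pos by (auto simp: T_def field_simps)
    then show ?thesis using pos by (simp add: T_def)
  qed
  have diff: "1 / (1 + T * x') - 1 / (1 + T * y')
      = - (T / (1 + T)) * ((1 + T) * x' / (1 + T * x') - (1 + T) * y' / (1 + T * y'))"
  proof -
    have *: "1 / (1 + T * z) = 1 - T / (1 + T) * ((1 + T) * z / (1 + T * z))" if "0 \<le> z" for z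
    proof -
      have "0 < 1 + T * z" using that T by (simp add: add_pos_nonneg)
      then have "1 + T * z \<noteq> 0" "1 + T \<noteq> 0" using T by auto
      then show ?thesis by (simp add: divide_simps)
    qed
    show ?thesis using *[OF nn(1)] *[OF nn(2)] by (simp add: algebra_simps)
  qed
  have dp: "digit_prob t d = (1 + t) * T * (T / (1 + T))"
    using Cons.prems(1) by (simp add: digit_prob_def T_def divide_simps) 
  have "\<bar>(1 + t) * x / (1 + t * x) - (1 + t) * y / (1 + t * y)\<bar>
      = \<bar>(1 + t) * T * (1 / (1 + T * x') - 1 / (1 + T * y'))\<bar>"
    unfolding x'(2) y'(2) img[OF nn(1)] img[OF nn(2)] by (simp add: algebra_simps)
  also have "\<dots> = digit_prob t d * \<bar>(1 + T) * x' / (1 + T * x') - (1 + T) * y' / (1 + T * y')\<bar>"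
    unfolding diff dp using T Cons.prems(1) by (simp add: abs_mult mult.assoc)
  also have "\<dots> \<le> digit_prob t d * cyl_length T w"
    using Cons.IH[of T x' y'] T x' y' digit_prob_pos[of t d] Cons.prems(1)
    by (intro mult_left_mono) auto
  finally show ?case by (simp add: T_def)
qed

lemma cf_interval_dist:
  "x \<in> cf_interval w \<Longrightarrow> y \<in> cf_interval w \<Longrightarrow> dist x y \<le> cyl_length 0 w"
  using cf_interval_distortion[of 0 x w y] by (simp add: dist_real_def)

lemma diameter_cf_interval_le: "diameter (cf_interval w) \<le> cyl_length 0 w"
  using cf_interval_dist[of _ w] less_imp_le[OF cyl_length_pos[of 0 w]]
  by (intro diameter_le) (auto simp: dist_real_def)

section \<open>Infinite continued fractions\<close>

lemma digit_word_0 [simp]: "digit_word a 0 = []"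
  by (simp add: digit_word_def)

lemma length_digit_word [simp]: "length (digit_word a n) = n"
  by (simp add: digit_word_def)

lemma digit_word_Suc: "digit_word a (Suc n) = (a 1 - 1) # digit_word (\<lambda>i. a (Suc i)) n"
  unfolding digit_word_def upt_conv_Cons[OF zero_less_Suc]
  by (simp add: map_Suc_upt[symmetric] del: upt_Suc)

lemma cf_approximant_bounds: "\<forall>i\<ge>1. 1 \<le> a i \<Longrightarrow> 0 \<le> cf_approximant n a \<and> cf_approximant n a \<le> 1"
proof (induction n arbitrary: a)
  case (Suc n)
  have "0 \<le> cf_approximant n (\<lambda>i. a (Suc i))" "1 \<le> real (a 1)"
    using Suc by auto
  then show ?case by (simp add: divide_simps)
qed simp

lemma cf_approximant_in_cf_interval:
  "\<forall>i\<ge>1. 1 \<le> a i \<Longrightarrow> n \<le> m \<Longrightarrow> cf_approximant m a \<in> cf_interval (digit_word a n)"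
proof (induction n arbitrary: a m)
  case 0
  then show ?case using cf_approximant_bounds by simp
next
  case (Suc n)
  obtain m' where m: "m = Suc m'" "n \<le> m'" using Suc.prems(2) by (cases m) auto
  have "cf_approximant m' (\<lambda>i. a (Suc i)) \<in> cf_interval (digit_word (\<lambda>i. a (Suc i)) n)"
    using Suc m by auto
  moreover have "real (a 1 - 1) + 1 = real (a 1)" using Suc.prems by simp
  ultimately show ?case by (auto simp: m digit_word_Suc)
qed

lemma cf_approximant_convergent:
  assumes "\<forall>i\<ge>1. 1 \<le> a i"
  shows "\<exists>x. (\<lambda>n. cf_approximant n a) \<longlonglongrightarrow> x"
proof -
  have "Cauchy (\<lambda>n. cf_approximant n a)"
  proof (rule metric_CauchyI)
    fix e :: real assume "0 < e"
    then obtain N where N: "(1 / 2 :: real) ^ N < e"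
      using real_arch_pow_inv[of e "1/2"] by auto
    have "dist (cf_approximant m a) (cf_approximant n a) < e" if "N \<le> m" "N \<le> n" for m n
      using cf_interval_dist[OF cf_approximant_in_cf_interval[OF assms that(1)]
          cf_approximant_in_cf_interval[OF assms that(2)]]
        cyl_length_le[of 0 "digit_word a N"] N by simp
    then show "\<exists>M. \<forall>m\<ge>M. \<forall>n\<ge>M. dist (cf_approximant m a) (cf_approximant n a) < e"
      by blast
  qed
  then show ?thesis using Cauchy_convergent_iff convergent_def by blast
qed

lemma cf_limit_recursion:
  assumes "\<forall>i\<ge>1. 1 \<le> a i"
    and "(\<lambda>n. cf_approximant n a) \<longlonglongrightarrow> x"
    and "(\<lambda>n. cf_approximant n (\<lambda>i. a (Suc i))) \<longlonglongrightarrow> x'"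
  shows "0 \<le> x'" "x = 1 / (real (a 1) + x')"
proof -
  show nn: "0 \<le> x'"
    using cf_approximant_bounds[of "\<lambda>i. a (Suc i)"] assms(1)
    by (intro LIMSEQ_le_const[OF assms(3)]) auto
  have "1 \<le> real (a 1)" using assms(1) by simp
  then have "(\<lambda>n. cf_approximant (Suc n) a) \<longlonglongrightarrow> 1 / (real (a 1) + x')"
    using nn by (auto intro!: tendsto_intros assms(3))
  moreover have "(\<lambda>n. cf_approximant (Suc n) a) \<longlonglongrightarrow> x"
    using assms(2) by (rule LIMSEQ_Suc)
  ultimately show "x = 1 / (real (a 1) + x')" by (metis LIMSEQ_unique)
qed

lemma cf_limit_in_unit_interval:
  assumes a: "\<forall>i\<ge>1. 1 \<le> a i" and x: "(\<lambda>n. cf_approximant n a) \<longlonglongrightarrow> x"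
  shows "0 < x" "x < 1"
proof -
  obtain x' where x': "(\<lambda>n. cf_approximant n (\<lambda>i. a (Suc i))) \<longlonglongrightarrow> x'"
    using cf_approximant_convergent[of "\<lambda>i. a (Suc i)"] a by auto
  obtain x'' where x'': "(\<lambda>n. cf_approximant n (\<lambda>i. a (Suc (Suc i)))) \<longlonglongrightarrow> x''"
    using cf_approximant_convergent[of "\<lambda>i. a (Suc (Suc i))"] a by auto
  note 1 = cf_limit_recursion[OF a x x']
  have 2: "0 \<le> x''" "x' = 1 / (real (a 2) + x'')"
    using cf_limit_recursion[OF _ x' x''] a by (auto simp: numeral_2_eq_2)
  have "1 \<le> real (a 1)" "1 \<le> real (a 2)" using a by auto
  then have "0 < x'" using 2 by auto
  then show "0 < x" "x < 1" using 1 \<open>1 \<le> real (a 1)\<close> by auto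
qed

text \<open>
  Descent: if the limit is \<open>p / q\<close>, then \<open>p < q\<close> and the limit of the shifted expansion is a
  fraction with denominator \<open>p\<close>.
\<close>

lemma cf_limit_not_fraction:
  assumes "\<forall>i\<ge>1. 1 \<le> a i" "(\<lambda>n. cf_approximant n a) \<longlonglongrightarrow> x" "0 < q"
  shows "x \<noteq> real p / real q"
  using assms
proof (induction q arbitrary: a x p rule: less_induct)
  case (less q)
  show ?case
  proof
    assume eq: "x = real p / real q"
    obtain x' where x': "(\<lambda>n. cf_approximant n (\<lambda>i. a (Suc i))) \<longlonglongrightarrow> x'"
      using cf_approximant_convergent[of "\<lambda>i. a (Suc i)"] less.prems by auto
    note rec = cf_limit_recursion[OF less.prems(1,2) x']
    have pq: "0 < p" "p < q"
      using cf_limit_in_unit_interval[OF less.prems(1,2)] less.prems(3)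
      unfolding eq by (auto simp: divide_simps split: if_splits)
    have "1 \<le> real (a 1)" using less.prems by simp
    then have "real (a 1) + x' = real q / real p"
      using rec eq pq by (simp add: field_simps)
    then have x'_eq: "x' = (real q - real (a 1) * real p) / real p"
      using pq by (simp add: field_simps)
    then have "0 \<le> real q - real (a 1) * real p"
      using rec(1) pq by (simp add: zero_le_divide_iff)
    then have "real (a 1 * p) \<le> real q" by simp
    then have "a 1 * p \<le> q" by (simp only: of_nat_le_iff)
    then have "x' = real (q - a 1 * p) / real p"
      using x'_eq by (simp add: of_nat_diff)
    moreover have "\<forall>i\<ge>1. 1 \<le> a (Suc i)" using less.prems(1) by simp
    ultimately show False
      using less.IH[OF pq(2) _ x' pq(1)] by blast
  qed
qed

lemma cf_limit_irrational:
  assumes a: "\<forall>i\<ge>1. 1 \<le> a i" and x: "(\<lambda>n. cf_approximant n a) \<longlonglongrightarrow> x"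
  shows "x \<in> unit_irrationals"
proof -
  have "x \<notin> \<rat>"
  proof
    assume "x \<in> \<rat>"
    then obtain p q :: nat where "q \<noteq> 0" "\<bar>x\<bar> = real p / real q"
      by (rule Rats_abs_nat_div_natE)
    then show False
      using cf_limit_not_fraction[OF a x, of q p] cf_limit_in_unit_interval[OF a x] by auto
  qed
  then show ?thesis
    using cf_limit_in_unit_interval[OF a x] by (simp add: unit_irrationals_def)
qed

lemma continued_fraction_limit:
  assumes "\<forall>i\<ge>1. 1 \<le> a i"
  shows "(\<lambda>n. cf_approximant n a) \<longlonglongrightarrow> continued_fraction a"
    and "continued_fraction a \<in> unit_irrationals"
proof -
  obtain x where x: "(\<lambda>n. cf_approximant n a) \<longlonglongrightarrow> x"
    using cf_approximant_convergent[OF assms] by blast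
  have "continued_fraction a = x"
    unfolding continued_fraction_def
    using x cf_limit_irrational[OF assms x] LIMSEQ_unique by blast
  then show "(\<lambda>n. cf_approximant n a) \<longlonglongrightarrow> continued_fraction a"
    and "continued_fraction a \<in> unit_irrationals"
    using x cf_limit_irrational[OF assms x] by auto
qed

lemma continued_fraction_in_cf_interval:
  assumes "\<forall>i\<ge>1. 1 \<le> a i"
  shows "continued_fraction a \<in> cf_interval (digit_word a n)"
proof (rule Lim_in_closed_set[OF compact_imp_closed[OF compact_cf_interval] _ _
        continued_fraction_limit(1)[OF assms]])
  show "\<forall>\<^sub>F m in sequentially. cf_approximant m a \<in> cf_interval (digit_word a n)"
    using cf_approximant_in_cf_interval[OF assms] eventually_sequentially by blast
qed simp

section \<open>Sums over words\<close>

text \<open>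
  Sums over all words of a fixed length are taken in \<^typ>\<open>ennreal\<close>, where they always exist.
\<close>

definition word_sum :: "nat \<Rightarrow> (nat list \<Rightarrow> ennreal) \<Rightarrow> ennreal" where
  "word_sum n f = (\<integral>\<^sup>+w. f w \<partial>count_space {w. length w = n})"

lemma word_sum_0: "word_sum 0 f = f []"
proof -
  have "{w::nat list. length w = 0} = {[]}" by auto
  then show ?thesis by (simp add: word_sum_def nn_integral_count_space_finite)
qed

lemma word_sum_Suc: "word_sum (Suc n) f = (\<Sum>d. word_sum n (\<lambda>w. f (d # w)))"
proof -
  let ?W = "{w::nat list. length w = n}"
  have bij: "bij_betw (\<lambda>p. fst p # snd p) (UNIV \<times> ?W) {w::nat list. length w = Suc n}"
    by (rule bij_betwI[where g = "\<lambda>w. (hd w, tl w)"]) (auto simp: length_Suc_conv)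
  have "word_sum (Suc n) f = (\<integral>\<^sup>+p. f (fst p # snd p) \<partial>count_space (UNIV \<times> ?W))"
    unfolding word_sum_def by (rule nn_integral_bij_count_space[OF bij, symmetric])
  also have "\<dots> = (\<integral>\<^sup>+p. f (fst p # snd p) * indicator ?W (snd p) \<partial>count_space UNIV)"
    by (subst nn_integral_count_space_indicator)
       (auto intro!: nn_integral_cong split: split_indicator)
  also have "\<dots> = (\<integral>\<^sup>+d. \<integral>\<^sup>+w. f (d # w) * indicator ?W w \<partial>count_space UNIV \<partial>count_space UNIV)"
    by (subst nn_integral_fst_count_space[symmetric]) simp
  also have "\<dots> = (\<integral>\<^sup>+d. word_sum n (\<lambda>w. f (d # w)) \<partial>count_space UNIV)"
    unfolding word_sum_def by (subst (2) nn_integral_count_space_indicator) auto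
  finally show ?thesis by (simp add: nn_integral_count_space_nat)
qed

lemma word_sum_cong: "(\<And>w. length w = n \<Longrightarrow> f w = g w) \<Longrightarrow> word_sum n f = word_sum n g"
  unfolding word_sum_def by (intro nn_integral_cong) auto

lemma word_sum_mono: "(\<And>w. length w = n \<Longrightarrow> f w \<le> g w) \<Longrightarrow> word_sum n f \<le> word_sum n g"
  unfolding word_sum_def by (intro nn_integral_mono) auto

lemma word_sum_add: "word_sum n (\<lambda>w. f w + g w) = word_sum n f + word_sum n g"
  unfolding word_sum_def by (intro nn_integral_add) auto

lemma word_sum_cmult: "word_sum n (\<lambda>w. c * f w) = c * word_sum n f"
  unfolding word_sum_def by (intro nn_integral_cmult) auto

lemma word_sum_append:
  "word_sum (m + n) f = word_sum m (\<lambda>w. word_sum n (\<lambda>u. f (w @ u)))"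
  by (induction m arbitrary: f) (simp_all add: word_sum_0 word_sum_Suc)

lemma sum_le_word_sum:
  assumes "finite V" "V \<subseteq> {w. length w = n}"
  shows "sum f V \<le> word_sum n f"
proof -
  have "sum f V = (\<integral>\<^sup>+w. f w \<partial>count_space V)"
    using assms by (simp add: nn_integral_count_space_finite)
  also have "\<dots> \<le> word_sum n f"
    unfolding word_sum_def using assms
    by (subst (1 2) nn_integral_count_space_indicator)
       (auto intro!: nn_integral_mono split: split_indicator)
  finally show ?thesis .
qed

section \<open>Digit statistics\<close>

lemma digit_prob_sums: 
  assumes "0 \<le> t" shows "digit_prob t sums 1"
proof -
  have "(\<lambda>n. (1 + t) / (real n + 1 + t)) \<longlonglongrightarrow> 0"
    by real_asymp
  then have "(\<lambda>n. (1 + t) / (real n + 1 + t) - (1 + t) / (real (Suc n) + 1 + t))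
      sums ((1 + t) / (real 0 + 1 + t) - 0)"
    by (rule telescope_sums')
  moreover have "(1 + t) / (real n + 1 + t) - (1 + t) / (real (Suc n) + 1 + t) = digit_prob t n" for n
    using assms by (simp add: digit_prob_def divide_simps) (simp add: algebra_simps)
  ultimately show ?thesis using assms by simp
qed

text \<open>
  Uniformly in \<open>t\<close>, the probability of the letter \<open>d\<close> is of order \<open>1 / (d + 1)\<^sup>2\<close>, so the
  sum of the \<open>s\<close>-th powers converges for every \<open>s > 1/2\<close>; the value \<open>3/4\<close> is an arbitrary choice.
\<close>

lemma digit_prob_powr_sum_bound:
  "\<exists>K\<ge>1. \<forall>t\<in>{0..1}. (\<Sum>d. ennreal (digit_prob t d powr (3/4))) \<le> ennreal K"
proof -
  define b where "b d = (2 * real (Suc d) powr -2) powr (3/4)" for d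
  have b: "b d = 2 powr (3/4) * real (Suc d) powr (-3/2)" for d
    by (simp add: b_def powr_mult powr_powr)
  have "summable (\<lambda>d. real (Suc d) powr (-3/2))"
    by (subst summable_Suc_iff) (simp add: summable_real_powr_iff)
  then have sb: "summable b" unfolding b by (rule summable_mult)
  have dp: "digit_prob t d \<le> 2 * real (Suc d) powr -2" if "t \<in> {0..1}" for t d
  proof -
    have "(1 + t) * (real d + 1)\<^sup>2 \<le> 2 * ((real d + 1 + t) * (real d + 2 + t))"
    proof -
      have "(real d + 1)\<^sup>2 \<le> (real d + 1 + t) * (real d + 2 + t)"
        unfolding power2_eq_square using that by (intro mult_mono) auto
      then have "(1 + t) * (real d + 1)\<^sup>2 \<le> 2 * ((real d + 1 + t) * (real d + 2 + t))"
        using that by (intro mult_mono) auto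
      then show ?thesis .
    qed
    then show ?thesis using that
      by (simp add: digit_prob_def powr_minus powr_numeral divide_simps add.commute mult.commute)
  qed
  have "(\<Sum>d. ennreal (digit_prob t d powr (3/4))) \<le> ennreal (max 1 (suminf b))" if "t \<in> {0..1}" for t
  proof -
    have "(\<Sum>d. ennreal (digit_prob t d powr (3/4))) \<le> (\<Sum>d. ennreal (b d))"
      unfolding b_def using dp[OF that] digit_prob_pos[of t] that
      by (intro suminf_le ennreal_leI powr_mono2) (auto simp: less_imp_le)
    also have "\<dots> = ennreal (suminf b)"
      by (rule suminf_ennreal2[OF _ sb]) (simp add: b_def)
    finally show ?thesis by (simp add: max_def ennreal_leI order_trans)
  qed
  then show ?thesis by (intro exI[of _ "max 1 (suminf b)"]) auto
qed

text \<open>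
  Lowering the exponent from \<open>1\<close> to \<open>1 - c\<close> costs only a factor close to \<open>1\<close> per letter: as
  \<open>1 - c = (1 - 4 c) \<cdot> 1 + 4 c \<cdot> (3/4)\<close>, Young's inequality interpolates between the total mass \<open>1\<close>
  and the moment of order \<open>3/4\<close>.
\<close>

lemma word_sum_cyl_length_powr:
  assumes K: "\<forall>t\<in>{0..1}. (\<Sum>d. ennreal (digit_prob t d powr (3/4))) \<le> ennreal K" "1 \<le> K"
    and c: "0 \<le> c" "c \<le> 1 / 4"
  shows "0 \<le> t \<Longrightarrow> t \<le> 1 \<Longrightarrow>
    word_sum n (\<lambda>w. ennreal (cyl_length t w powr (1 - c))) \<le> ennreal ((1 + 4 * c * K) ^ n)"
proof (induction n arbitrary: t)
  case (Suc n)
  let ?B = "(1 + 4 * c * K) ^ n"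
  have B: "0 \<le> ?B" using K c by simp
  have dp: "digit_prob t d powr (1 - c) \<le> digit_prob t d + 4 * c * digit_prob t d powr (3/4)" for d
  proof -
    let ?p = "digit_prob t d"
    have p: "0 < ?p" using Suc.prems digit_prob_pos by auto
    have "?p powr (1 - c) = ?p powr (1 - 4 * c) * (?p powr (3/4)) powr (4 * c)"
      by (simp add: powr_powr powr_add[symmetric])
    also have "\<dots> \<le> (1 - 4 * c) * ?p + 4 * c * ?p powr (3/4)"
      using p c by (intro Youngs_inequality_0) auto
    also have "\<dots> \<le> ?p + 4 * c * ?p powr (3/4)"
      using p c by (simp add: algebra_simps)
    finally show ?thesis .
  qed
  have "word_sum (Suc n) (\<lambda>w. ennreal (cyl_length t w powr (1 - c)))
      = (\<Sum>d. ennreal (digit_prob t d powr (1 - c)) *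
          word_sum n (\<lambda>w. ennreal (cyl_length (1 / (real d + 1 + t)) w powr (1 - c))))"
    unfolding word_sum_Suc word_sum_cmult[symmetric]
    using Suc.prems by (intro suminf_cong word_sum_cong)
      (simp add: powr_mult ennreal_mult[symmetric] digit_prob_pos cyl_length_pos less_imp_le)
  also have "\<dots> \<le> (\<Sum>d. ennreal (digit_prob t d powr (1 - c)) * ennreal ?B)"
    using next_param_bounds[OF Suc.prems(1)] by (intro suminf_le mult_left_mono Suc.IH) auto
  also have "\<dots> = (\<Sum>d. ennreal (digit_prob t d powr (1 - c))) * ennreal ?B"
    by simp
  also have "\<dots> \<le> ennreal (1 + 4 * c * K) * ennreal ?B"
  proof (rule mult_right_mono)
    have "(\<Sum>d. ennreal (digit_prob t d powr (1 - c)))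
        \<le> (\<Sum>d. ennreal (digit_prob t d) + ennreal (4 * c) * ennreal (digit_prob t d powr (3/4)))"
      using dp Suc.prems c digit_prob_pos[of t]
      by (intro suminf_le) (auto simp: ennreal_mult[symmetric] ennreal_plus[symmetric] less_imp_le
          simp del: ennreal_plus intro!: ennreal_leI)
    also have "\<dots> = (\<Sum>d. ennreal (digit_prob t d))
        + ennreal (4 * c) * (\<Sum>d. ennreal (digit_prob t d powr (3/4)))"
      by (simp add: suminf_add[symmetric])
    also have "\<dots> \<le> 1 + ennreal (4 * c) * ennreal K"
      using digit_prob_sums[of t] Suc.prems K(1) digit_prob_pos[of t]
      by (intro add_mono mult_left_mono)
         (auto simp: suminf_ennreal2 sums_iff less_imp_le)
    also have "\<dots> = ennreal (1 + 4 * c * K)"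
      using K c by (simp add: ennreal_mult[symmetric] ennreal_plus[symmetric] del: ennreal_plus flip: ennreal_1)
    finally show "(\<Sum>d. ennreal (digit_prob t d powr (1 - c))) \<le> ennreal (1 + 4 * c * K)" .
  qed simp
  also have "\<dots> = ennreal ((1 + 4 * c * K) ^ Suc n)"
    using K c by (simp add: ennreal_mult[symmetric] del: ennreal_plus)
  finally show ?case .
qed (simp add: word_sum_0)

section \<open>The gap for one block\<close>

lemma powr_diff_ge:
  fixes A B r :: real
  assumes "0 < A" "A \<le> 1" "0 < B" "B \<le> 1" "0 \<le> r" "r \<le> 1"
  shows "r * \<bar>A - B\<bar> \<le> \<bar>A powr r - B powr r\<bar>"
proof -
  have *: "r * (A - B) \<le> A powr r - B powr r"
    if "0 < A" "A \<le> 1" "0 < B" "B \<le> A" for A B :: real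
  proof -
    have "(B / A) powr r * 1 powr (1 - r) \<le> r * (B / A) + (1 - r) * 1"
      using that assms by (intro Youngs_inequality_0) auto
    then have "(B / A) powr r \<le> 1 - r * ((A - B) / A)"
      using that by (simp add: diff_divide_distrib algebra_simps)
    then have "A powr r * (B / A) powr r \<le> A powr r * (1 - r * ((A - B) / A))"
      by (intro mult_left_mono) auto
    moreover have "A powr r * (B / A) powr r = B powr r"
      using that by (simp add: powr_mult[symmetric])
    moreover have "1 * (A - B) \<le> (A powr r / A) * (A - B)"
    proof (rule mult_right_mono)
      have "A powr 1 \<le> A powr r"
        using that assms by (intro powr_mono') auto
      then show "1 \<le> A powr r / A" using that by simp
    qed (use that in simp)
    then have "r * (A - B) \<le> r * ((A powr r / A) * (A - B))"
      using assms by (intro mult_left_mono) auto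
    ultimately show ?thesis by (simp add: algebra_simps)
  qed
  show ?thesis
    using *[of A B] *[of B A] assms by (cases "B \<le> A") (auto simp: abs_if)
qed

text \<open>
  Two letters separated by \<open>k\<close> letters \<open>0\<close>, that is, by \<open>k\<close> partial quotients \<open>1\<close>. In a chain of
  order \<open>k\<close> the two outer letters are independent given the past and the middle.
\<close>

definition probe_word :: "nat \<Rightarrow> nat \<Rightarrow> nat \<Rightarrow> nat list" where
  "probe_word k i j = i # replicate k 0 @ [j]"

text \<open>
  A lower bound for the determinant in \<open>cyl_length_probe_det\<close>, kept as the product of the factors
  in which it arises there.
\<close>

definition gap :: "nat \<Rightarrow> real" where
  "gap k = (1 / 36) * (1 / 9) ^ k * ((1 / 4) * ((1 / 432) * (1 / 4) ^ k))"

lemma gap_pos: "0 < gap k"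
  by (simp add: gap_def)

text \<open>
  The influence of the first letter on the parameter survives a run of partial quotients \<open>1\<close>: it
  shrinks by a factor of at most \<open>4\<close> per step, because \<open>x \<mapsto> 1 / (1 + x)\<close> has derivative at least
  \<open>1/4\<close> in absolute value on \<open>[0, 1]\<close>.
\<close>

lemma cyl_param_ones_expansion:
  "0 \<le> t \<Longrightarrow> t \<le> 1 \<Longrightarrow> 0 \<le> u \<Longrightarrow> u \<le> 1 \<Longrightarrow>
    \<bar>t - u\<bar> * (1 / 4) ^ k \<le> \<bar>cyl_param t (replicate k 0) - cyl_param u (replicate k 0)\<bar>"
proof (induction k arbitrary: t u)
  case (Suc k)
  have "1 / (1 + t) - 1 / (1 + u) = (u - t) / ((1 + t) * (1 + u))"
    using Suc.prems by (simp add: divide_simps)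
  moreover have "(1 + t) * (1 + u) \<le> 2 * 2" "0 < (1 + t) * (1 + u)"
    using Suc.prems by (intro mult_mono mult_pos_pos; simp)+
  ultimately have "\<bar>t - u\<bar> / 4 \<le> \<bar>1 / (1 + t) - 1 / (1 + u)\<bar>"
    using frac_le[of "\<bar>u - t\<bar>" "\<bar>u - t\<bar>" "(1 + t) * (1 + u)" 4]
    by (simp only: abs_divide abs_of_pos abs_minus_commute[of t u])
  then have "\<bar>t - u\<bar> / 4 * (1 / 4) ^ k \<le> \<bar>1 / (1 + t) - 1 / (1 + u)\<bar> * (1 / 4) ^ k"
    by (intro mult_right_mono) auto
  also have "\<dots> \<le> \<bar>cyl_param (1 / (1 + t)) (replicate k 0) - cyl_param (1 / (1 + u)) (replicate k 0)\<bar>"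
    using Suc.prems by (intro Suc.IH) auto
  finally show ?case by simp
qed simp

lemma cyl_length_ones_ge: "0 \<le> t \<Longrightarrow> t \<le> 1 \<Longrightarrow> (1 / 3) ^ k \<le> cyl_length t (replicate k 0)"
proof (induction k arbitrary: t)
  case (Suc k)
  have "1 / 3 \<le> digit_prob t 0"
    using Suc.prems by (simp add: digit_prob_def divide_simps)
  moreover have "(1 / 3) ^ k \<le> cyl_length (1 / (1 + t)) (replicate k 0)"
    using Suc.prems by (intro Suc.IH) auto
  ultimately have "1 / 3 * (1 / 3) ^ k \<le> digit_prob t 0 * cyl_length (1 / (1 + t)) (replicate k 0)"
    using Suc.prems digit_prob_pos[of t 0] by (intro mult_mono) auto
  then show ?case by simp
qed simp

text \<open>
  Different parameters are visible in a single digit: the ratio of the probabilities of the letters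
  \<open>0\<close> and \<open>1\<close> is \<open>(3 + t) / (1 + t)\<close>, which is strictly monotone in \<open>t\<close>.
\<close>

lemma digit_prob_cross_ratio:
  assumes "0 \<le> t" "t \<le> 1" "0 \<le> u" "u \<le> 1"
  shows "\<bar>t - u\<bar> / 72 \<le> \<bar>digit_prob t 0 * digit_prob u 1 - digit_prob t 1 * digit_prob u 0\<bar>"
proof -
  define D where "D = (2 + t) * (2 + u) * ((3 + t) * (3 + u))"
  have "D \<le> 3 * 3 * (4 * 4)"
    unfolding D_def using assms by (intro mult_mono mult_nonneg_nonneg) auto
  moreover have D: "0 < D"
    unfolding D_def using assms by (intro mult_pos_pos) auto
  moreover have "digit_prob t 0 * digit_prob u 1 - digit_prob t 1 * digit_prob u 0 = 2 * (u - t) / D"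
  proof -
    have "1 + t \<noteq> 0" "2 + t \<noteq> 0" "3 + t \<noteq> 0" "1 + u \<noteq> 0" "2 + u \<noteq> 0" "3 + u \<noteq> 0"
      using assms by auto
    then show ?thesis
      by (simp add: digit_prob_def D_def add.commute divide_simps) (simp add: algebra_simps)
  qed
  ultimately have "\<bar>digit_prob t 0 * digit_prob u 1 - digit_prob t 1 * digit_prob u 0\<bar> = 2 * \<bar>t - u\<bar> / D"
    by (simp only: abs_divide abs_mult abs_numeral abs_of_pos abs_minus_commute[of u t])
  moreover have "2 * \<bar>t - u\<bar> / 144 \<le> 2 * \<bar>t - u\<bar> / D"
    using D \<open>D \<le> 3 * 3 * (4 * 4)\<close> by (intro frac_le) auto
  ultimately show ?thesis by simp
qed

text \<open>
  Under Lebesgue measure the outer letters of a probe word are dependent, by an amount that does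
  not depend on the past \<open>t\<close>: the matrix of the lengths of the four probe words with outer letters
  in \<open>{0, 1}\<close> has a determinant bounded away from \<open>0\<close>, and so has the matrix of their \<open>r\<close>-th
  powers. Any matrix of joint probabilities of independent letters has determinant \<open>0\<close>,
  and so has the matrix of their square roots.

  In the proof, \<open>\<tau> i\<close> is the parameter seen by the last letter when the first one is \<open>i\<close>, and
  \<open>G i\<close> is the length contributed by all letters before the last.
\<close>

lemma cyl_length_probe_det:
  fixes k :: nat
  assumes t: "0 \<le> t" "t \<le> 1" and r: "1 / 4 \<le> r" "r \<le> 1"
  defines "y \<equiv> \<lambda>i j. cyl_length t (probe_word k i j) powr r"
  shows "gap k \<le> \<bar>y 0 0 * y 1 1 - y 0 1 * y 1 0\<bar>"
proof -
  define T where "T i = 1 / (real i + 1 + t)" for i :: nat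
  define \<tau> where "\<tau> i = cyl_param (T i) (replicate k 0)" for i
  define G where "G i = digit_prob t i * cyl_length (T i) (replicate k 0)" for i
  have T: "0 \<le> T i" "T i \<le> 1" for i
    unfolding T_def using next_param_bounds[OF t(1)] by auto
  have \<tau>: "0 \<le> \<tau> i" "\<tau> i \<le> 1" for i
    unfolding \<tau>_def using cyl_param_bounds[OF T] by auto
  have G: "0 < G i" "G i \<le> 1" for i
    using cyl_length_pos[of t "i # replicate k 0"] cyl_length_le_1[of t "i # replicate k 0"] t
    by (auto simp: G_def T_def)
  have p: "0 < digit_prob (\<tau> i) j" "digit_prob (\<tau> i) j \<le> 1" for i j
    using digit_prob_pos[OF \<tau>(1)] order_trans[OF digit_prob_le_half[OF \<tau>(1)], of 1] by auto
  have y: "y i j = G i powr r * digit_prob (\<tau> i) j powr r" for i j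
    unfolding y_def probe_word_def
    using G p by (simp add: cyl_length_append G_def \<tau>_def T_def powr_mult less_imp_le)
  have 1: "(1 / 36) * (1 / 9) ^ k \<le> (G 0 * G 1) powr r"
  proof -
    have "1 / 6 \<le> digit_prob t i" if "i \<in> {0, 1}" for i
    proof -
      have "t * t \<le> t * 1" using t by (intro mult_left_mono) auto
      then have "(2 + t) * (3 + t) \<le> (1 + t) * 6" by (simp add: algebra_simps)
      moreover have "(1 + t) * (2 + t) \<le> (1 + t) * 6" using t by (intro mult_left_mono) auto
      ultimately show ?thesis
        using that t by (auto simp: digit_prob_def divide_simps add.commute)
    qed
    then have "1 / 6 * (1 / 3) ^ k \<le> G i" if "i \<in> {0, 1}" for i
      unfolding G_def using that cyl_length_ones_ge[OF T] digit_prob_pos[OF t(1)]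
      by (intro mult_mono) (auto simp: less_imp_le)
    then have "(1 / 6 * (1 / 3) ^ k) * (1 / 6 * (1 / 3) ^ k) \<le> G 0 * G 1"
      using G by (intro mult_mono) (auto simp: less_imp_le)
    also have "G 0 * G 1 \<le> (G 0 * G 1) powr r"
      using powr_mono'[of r 1 "G 0 * G 1"] r G by (simp add: mult_le_one less_imp_le)
    also have "(1 / 6 * (1 / 3) ^ k) * (1 / 6 * (1 / 3) ^ k) = (1 / 36) * (1 / 9 :: real) ^ k"
      by (simp add: power_mult_distrib[symmetric] power_divide) 
    finally show ?thesis by simp
  qed
  define A B where "A = digit_prob (\<tau> 0) 0 * digit_prob (\<tau> 1) 1"
    and "B = digit_prob (\<tau> 0) 1 * digit_prob (\<tau> 1) 0"
  have AB: "0 < A" "A \<le> 1" "0 < B" "B \<le> 1"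
    unfolding A_def B_def using p by (auto intro!: mult_le_one mult_pos_pos simp: less_imp_le)
  have 2: "1 / 432 * (1 / 4) ^ k \<le> \<bar>A - B\<bar>"
  proof -
    have "1 / 6 \<le> T 0 - T 1"
    proof -
      have "(1 + t) * (2 + t) \<le> 2 * 3" "0 < (1 + t) * (2 + t)"
        using t by (intro mult_mono mult_pos_pos; simp)+
      moreover have "T 0 - T 1 = 1 / ((1 + t) * (2 + t))"
        using t by (simp add: T_def divide_simps)
      ultimately show ?thesis by (simp add: frac_le)
    qed
    then have "1 / 6 * (1 / 4) ^ k \<le> \<bar>T 0 - T 1\<bar> * (1 / 4) ^ k"
      by (intro mult_right_mono) auto
    also have "\<dots> \<le> \<bar>\<tau> 0 - \<tau> 1\<bar>"
      unfolding \<tau>_def by (intro cyl_param_ones_expansion T)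
    finally show ?thesis
      using digit_prob_cross_ratio[OF \<tau>[of 0] \<tau>[of 1]] by (simp add: A_def B_def)
  qed
  have 3: "(1 / 4) * (1 / 432 * (1 / 4) ^ k) \<le> \<bar>A powr r - B powr r\<bar>"
  proof -
    have "(1 / 4) * (1 / 432 * (1 / 4) ^ k) \<le> r * \<bar>A - B\<bar>"
      using 2 r by (intro mult_mono) auto
    also have "\<dots> \<le> \<bar>A powr r - B powr r\<bar>"
      using AB r by (intro powr_diff_ge) auto
    finally show ?thesis .
  qed
  have "gap k \<le> (G 0 * G 1) powr r * \<bar>A powr r - B powr r\<bar>"
    unfolding gap_def using 1 3 by (intro mult_mono) auto
  also have "\<dots> = \<bar>(G 0 * G 1) powr r * (A powr r - B powr r)\<bar>"
    by (simp add: abs_mult)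
  also have "(G 0 * G 1) powr r * (A powr r - B powr r) = y 0 0 * y 1 1 - y 0 1 * y 1 0"
    using G p by (simp add: y A_def B_def powr_mult less_imp_le algebra_simps)
  finally show ?thesis .
qed

text \<open>The determinant of a matrix measures its distance from the matrices of rank one.\<close>

lemma det_le_sum_squared_diff:
  fixes y z :: "nat \<Rightarrow> nat \<Rightarrow> real"
  assumes y: "\<And>i j. 0 \<le> y i j" "\<And>i j. y i j \<le> 1" and z: "\<And>i j. 0 \<le> z i j" "\<And>i j. z i j \<le> 1"
    and rank1: "z 0 0 * z 1 1 = z 0 1 * z 1 0"
  shows "(y 0 0 * y 1 1 - y 0 1 * y 1 0)\<^sup>2
    \<le> 4 * ((y 0 0 - z 0 0)\<^sup>2 + (y 0 1 - z 0 1)\<^sup>2 + (y 1 0 - z 1 0)\<^sup>2 + (y 1 1 - z 1 1)\<^sup>2)"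
proof -
  have *: "\<bar>y i j * y i' j' - z i j * z i' j'\<bar> \<le> \<bar>y i j - z i j\<bar> + \<bar>y i' j' - z i' j'\<bar>" for i j i' j'
  proof -
    have "y i j * y i' j' - z i j * z i' j' = y i j * (y i' j' - z i' j') + z i' j' * (y i j - z i j)"
      by (simp add: algebra_simps)
    also have "\<bar>\<dots>\<bar> \<le> y i j * \<bar>y i' j' - z i' j'\<bar> + z i' j' * \<bar>y i j - z i j\<bar>"
      using y z by (intro order_trans[OF abs_triangle_ineq]) (simp add: abs_mult)
    also have "\<dots> \<le> 1 * \<bar>y i' j' - z i' j'\<bar> + 1 * \<bar>y i j - z i j\<bar>"
      using y z by (intro add_mono mult_right_mono) auto
    finally show ?thesis by simp
  qed
  define a b c d where "a = \<bar>y 0 0 - z 0 0\<bar>" and "b = \<bar>y 0 1 - z 0 1\<bar>"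
    and "c = \<bar>y 1 0 - z 1 0\<bar>" and "d = \<bar>y 1 1 - z 1 1\<bar>"
  have "\<bar>y 0 0 * y 1 1 - y 0 1 * y 1 0\<bar> \<le> a + b + c + d"
    using *[of 0 0 1 1] *[of 0 1 1 0] rank1 unfolding a_def b_def c_def d_def by linarith
  then have "(y 0 0 * y 1 1 - y 0 1 * y 1 0)\<^sup>2 \<le> (a + b + c + d)\<^sup>2"
    by (metis abs_ge_zero power2_abs power_mono)
  also have "\<dots> \<le> 4 * (a\<^sup>2 + b\<^sup>2 + c\<^sup>2 + d\<^sup>2)"
  proof -
    have "4 * (a\<^sup>2 + b\<^sup>2 + c\<^sup>2 + d\<^sup>2) - (a + b + c + d)\<^sup>2
      = (a - b)\<^sup>2 + (a - c)\<^sup>2 + (a - d)\<^sup>2 + (b - c)\<^sup>2 + (b - d)\<^sup>2 + (c - d)\<^sup>2"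
      by (simp add: power2_eq_square algebra_simps)
    then show ?thesis using zero_le_power2[of "a-b"] zero_le_power2[of "a-c"] zero_le_power2[of "a-d"]
       zero_le_power2[of "b-c"] zero_le_power2[of "b-d"] zero_le_power2[of "c-d"] by linarith
  qed
  finally show ?thesis by (simp add: a_def b_def c_def d_def)
qed

text \<open>
  This is the source of the dimension gap. With \<open>y = |u|\<^sup>r\<close> and \<open>z = \<surd>(\<kappa> u)\<close>, the identity
  \<open>2 y z = y\<^sup>2 + z\<^sup>2 - (y - z)\<^sup>2\<close> turns the two normalisations into a bound by roughly \<open>1\<close>, and the
  four probe words alone make the sum of \<open>(y - z)\<^sup>2\<close> at least \<open>(gap k)\<^sup>2 / 4\<close>. The slack
  \<open>(gap k)\<^sup>2 / 8\<close> granted to the sum of \<open>y\<^sup>2\<close> leaves half of this gain.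
\<close>

lemma block_affinity_bound:
  fixes \<kappa> :: "nat list \<Rightarrow> real"
  assumes t: "0 \<le> t" "t \<le> 1" and r: "1 / 4 \<le> r" "r \<le> 1"
    and \<kappa>: "\<And>u. 0 \<le> \<kappa> u" "word_sum (k + 2) (\<lambda>u. ennreal (\<kappa> u)) \<le> 1"
    and rank1: "\<kappa> (probe_word k 0 0) * \<kappa> (probe_word k 1 1) = \<kappa> (probe_word k 0 1) * \<kappa> (probe_word k 1 0)"
    and len: "word_sum (k + 2) (\<lambda>u. ennreal (cyl_length t u powr (2 * r))) \<le> ennreal (1 + (gap k)\<^sup>2 / 8)"
  shows "word_sum (k + 2) (\<lambda>u. ennreal (cyl_length t u powr r * sqrt (\<kappa> u))) \<le> ennreal (1 - (gap k)\<^sup>2 / 16)"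
proof -
  define y where "y u = cyl_length t u powr r" for u
  define z where "z u = sqrt (\<kappa> u)" for u
  let ?\<Sigma> = "\<lambda>f. word_sum (k + 2) (\<lambda>u. ennreal (f u))"
  let ?P = "(\<lambda>(i, j). probe_word k i j) ` ({0, 1} \<times> {0, 1})"
  have nn: "0 \<le> y u" "0 \<le> z u" for u by (auto simp: y_def z_def \<kappa>)
  have y1: "y u \<le> 1" for u
    unfolding y_def using cyl_length_pos[of t u] cyl_length_le_1[of t u] t r
    by (intro powr_le1) auto
  have z1: "z u \<le> 1" if "length u = k + 2" for u
  proof -
    have "ennreal (\<kappa> u) \<le> word_sum (k + 2) (\<lambda>u. ennreal (\<kappa> u))"
      using sum_le_word_sum[of "{u}" "k + 2" "\<lambda>u. ennreal (\<kappa> u)"] that by simp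
    then have "ennreal (\<kappa> u) \<le> 1" using \<kappa>(2) by (rule order_trans)
    then show ?thesis by (simp add: z_def)
  qed
  have len_probe: "length (probe_word k i j) = k + 2" for i j
    by (simp add: probe_word_def)
  have "(gap k)\<^sup>2 / 4 \<le> (\<Sum>u\<in>?P. (y u - z u)\<^sup>2)"
  proof -
    have inj: "inj_on (\<lambda>(i, j). probe_word k i j) ({0, 1} \<times> {0, 1})"
      by (auto simp: inj_on_def probe_word_def)
    define yy where "yy i j = y (probe_word k i j)" for i j
    define zz where "zz i j = z (probe_word k i j)" for i j
    have "(gap k)\<^sup>2 \<le> \<bar>yy 0 0 * yy 1 1 - yy 0 1 * yy 1 0\<bar>\<^sup>2"
      using cyl_length_probe_det[OF t r, of k] gap_pos[of k] unfolding yy_def y_def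
      by (intro power_mono) auto
    also have "\<dots> \<le> 4 * ((yy 0 0 - zz 0 0)\<^sup>2 + (yy 0 1 - zz 0 1)\<^sup>2 + (yy 1 0 - zz 1 0)\<^sup>2 + (yy 1 1 - zz 1 1)\<^sup>2)"
      unfolding power2_abs
    proof (rule det_le_sum_squared_diff)
      show "zz 0 0 * zz 1 1 = zz 0 1 * zz 1 0"
        using rank1 by (simp add: zz_def z_def real_sqrt_mult[symmetric])
    qed (auto simp: yy_def zz_def nn y1 z1 len_probe)
    also have "(yy 0 0 - zz 0 0)\<^sup>2 + (yy 0 1 - zz 0 1)\<^sup>2 + (yy 1 0 - zz 1 0)\<^sup>2 + (yy 1 1 - zz 1 1)\<^sup>2
       = (\<Sum>u\<in>?P. (y u - z u)\<^sup>2)"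
      unfolding sum.reindex[OF inj]
      by (simp add: sum.cartesian_product[symmetric] o_def case_prod_beta yy_def zz_def)
    finally show ?thesis by simp
  qed
  then have "ennreal ((gap k)\<^sup>2 / 4) \<le> ennreal (\<Sum>u\<in>?P. (y u - z u)\<^sup>2)"
    by (rule ennreal_leI)
  also have "\<dots> = (\<Sum>u\<in>?P. ennreal ((y u - z u)\<^sup>2))"
    by (rule sum_ennreal[symmetric]) simp
  also have "\<dots> \<le> ?\<Sigma> (\<lambda>u. (y u - z u)\<^sup>2)"
    by (rule sum_le_word_sum) (auto simp: len_probe)
  finally have diff: "ennreal ((gap k)\<^sup>2 / 4) \<le> ?\<Sigma> (\<lambda>u. (y u - z u)\<^sup>2)" .
  have "2 * ?\<Sigma> (\<lambda>u. y u * z u) + ?\<Sigma> (\<lambda>u. (y u - z u)\<^sup>2) = ?\<Sigma> (\<lambda>u. (y u)\<^sup>2) + ?\<Sigma> (\<lambda>u. (z u)\<^sup>2)"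
    unfolding word_sum_cmult[symmetric] word_sum_add[symmetric]
  proof (rule word_sum_cong)
    fix u
    have "2 * (y u * z u) + (y u - z u)\<^sup>2 = (y u)\<^sup>2 + (z u)\<^sup>2"
      by (simp add: power2_eq_square algebra_simps)
    then have "ennreal (2 * (y u * z u)) + ennreal ((y u - z u)\<^sup>2) = ennreal ((y u)\<^sup>2) + ennreal ((z u)\<^sup>2)"
      using nn by (simp add: ennreal_plus[symmetric] del: ennreal_plus)
    then show "2 * ennreal (y u * z u) + ennreal ((y u - z u)\<^sup>2) = ennreal ((y u)\<^sup>2) + ennreal ((z u)\<^sup>2)"
      using nn by (simp add: ennreal_mult)
  qed
  also have "\<dots> \<le> ennreal (1 + (gap k)\<^sup>2 / 8) + 1"
  proof (rule add_mono)
    show "?\<Sigma> (\<lambda>u. (y u)\<^sup>2) \<le> ennreal (1 + (gap k)\<^sup>2 / 8)"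
      using len by (simp add: y_def power2_eq_square powr_add[symmetric])
    show "?\<Sigma> (\<lambda>u. (z u)\<^sup>2) \<le> 1"
      using \<kappa> by (simp add: z_def)
  qed
  finally have "2 * ?\<Sigma> (\<lambda>u. y u * z u) + ?\<Sigma> (\<lambda>u. (y u - z u)\<^sup>2) \<le> ennreal (2 + (gap k)\<^sup>2 / 8)"
    by (simp add: ennreal_1[symmetric] ennreal_plus[symmetric] del: ennreal_1 ennreal_plus)
  then have total: "2 * ?\<Sigma> (\<lambda>u. y u * z u) + ennreal ((gap k)\<^sup>2 / 4) \<le> ennreal (2 + (gap k)\<^sup>2 / 8)"
    using add_left_mono[OF diff] by (rule order_trans[rotated])
  have "?\<Sigma> (\<lambda>u. y u * z u) \<le> ennreal (1 - (gap k)\<^sup>2 / 16)"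
  proof (cases "?\<Sigma> (\<lambda>u. y u * z u)")
    case (real x)
    have "2 * ennreal x = ennreal (2 * x)"
      using real by (simp add: ennreal_mult)
    then have "2 * x + (gap k)\<^sup>2 / 4 \<le> 2 + (gap k)\<^sup>2 / 8"
      using total real by (simp add: ennreal_plus[symmetric] del: ennreal_plus)
    then show ?thesis using real by (simp add: ennreal_leI)
  next
    case top
    then show ?thesis using total by (simp add: ennreal_mult_top top_unique)
  qed
  then show ?thesis by (simp add: y_def z_def)
qed

section \<open>A Cantelli lemma for Hausdorff measure\<close>

text \<open>
  The tails of the family are covers of \<open>E\<close> by arbitrarily small sets, and their costs are the
  tails of a convergent series.
\<close>

lemma hausdorff_measure_limsup_eq_0:
  fixes U :: "nat \<Rightarrow> 'a::metric_space set"
  assumes s: "0 < s" and bounded: "\<And>i. bounded (U i)"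
    and fin: "(\<Sum>i. ennreal (diameter (U i) powr s)) \<noteq> \<top>"
    and E: "E \<subseteq> {x. \<exists>\<^sub>\<infinity>i. x \<in> U i}"
  shows "hausdorff_measure s E = 0"
proof -
  define f where "f i = diameter (U i) powr s" for i
  have summ: "summable f"
    using fin by (intro summable_suminf_not_top) (auto simp: f_def)
  have "hausdorff_premeasure s \<delta> E \<le> 0" if "0 < \<delta>" for \<delta>
  proof (rule LIMSEQ_le_const)
    show "(\<lambda>n. ennreal (\<Sum>i. f (i + n))) \<longlonglongrightarrow> 0"
      unfolding ennreal_0[symmetric] by (intro tendsto_ennrealI suminf_exist_split2 summ)
    have "eventually (\<lambda>n. f n < \<delta> powr s) sequentially"
      using summable_LIMSEQ_zero[OF summ] that by (intro order_tendstoD) auto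
    then obtain N where N: "\<And>n. N \<le> n \<Longrightarrow> f n < \<delta> powr s"
      unfolding eventually_sequentially by blast
    have "hausdorff_premeasure s \<delta> E \<le> ennreal (\<Sum>i. f (i + n))" if "N \<le> n" for n
    proof -
      have "hausdorff_premeasure s \<delta> E \<le> (\<Sum>i. ennreal (diameter (U (i + n)) powr s))"
        unfolding hausdorff_premeasure_def
      proof (rule INF_lower, safe)
        fix x assume "x \<in> E"
        then have "\<exists>\<^sub>\<infinity>i. x \<in> U i" using E by auto
        then obtain i where "n \<le> i" "x \<in> U i" unfolding INFM_nat_le by blast
        then show "x \<in> (\<Union>i. U (i + n))" by (auto intro!: exI[of _ "i - n"])
      next
        fix i
        show "diameter (U (i + n)) \<le> \<delta>"
        proof (rule ccontr)
          assume "\<not> diameter (U (i + n)) \<le> \<delta>"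
          then have "\<delta> powr s \<le> f (i + n)"
            unfolding f_def using \<open>0 < \<delta>\<close> s by (intro powr_mono2) auto
          then show False using N[of "i + n"] that by auto
        qed
      qed (rule bounded)
      also have "\<dots> = ennreal (\<Sum>i. f (i + n))"
        unfolding f_def[symmetric] using summ
        by (intro suminf_ennreal2) (auto simp: summable_iff_shift, simp add: f_def)
      finally show ?thesis .
    qed
    then show "\<exists>N. \<forall>n\<ge>N. hausdorff_premeasure s \<delta> E \<le> ennreal (\<Sum>i. f (i + n))" by blast
  qed
  then show ?thesis
    unfolding hausdorff_measure_def by (intro antisym SUP_least) auto
qed

text \<open>Covers are sequences of sets, while the natural index of a cylinder is its word.\<close>

lemma suminf_list_decode:
  fixes g :: "nat list \<Rightarrow> ennreal"
  shows "(\<Sum>i. g (list_decode i)) = (\<integral>\<^sup>+w. g w \<partial>count_space UNIV)"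
  using nn_integral_bij_count_space[OF bij_list_decode, of g]
  by (simp add: nn_integral_count_space_nat)

section \<open>Digit processes\<close>

lemma ball_atLeast1_atMost: "(\<forall>i\<in>{1..n::nat}. P i) \<longleftrightarrow> (\<forall>i<n. P (Suc i))"
proof (intro iffI ballI)
  fix i assume "\<forall>i<n. P (Suc i)" "i \<in> {1..n}"
  then show "P i" by (cases i) auto
qed auto

locale digit_process = prob_space M for M :: "'a measure" +
  fixes A :: "nat \<Rightarrow> 'a \<Rightarrow> nat"
  assumes digit_measurable: "1 \<le> n \<Longrightarrow> A n \<in> measurable M (count_space {1..})"
begin

definition cylinder :: "nat list \<Rightarrow> 'a set" where
  "cylinder w = {\<omega> \<in> space M. \<forall>i<length w. A (Suc i) \<omega> = Suc (w ! i)}"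

lemma digit_ge_1: "\<omega> \<in> space M \<Longrightarrow> \<forall>n\<ge>1. 1 \<le> A n \<omega>"
  using measurable_space[OF digit_measurable] by auto

lemma digit_measurable_UNIV [measurable]: "A (Suc n) \<in> measurable M (count_space UNIV)"
proof -
  have "(\<lambda>x. x) \<in> measurable (count_space {1::nat..}) (count_space UNIV)" by simp
  from measurable_compose[OF digit_measurable this] show ?thesis by simp
qed

lemma cylinder_sets [measurable]: "cylinder w \<in> sets M"
  unfolding cylinder_def by measurable

lemma in_cylinder_digit_word: "\<omega> \<in> space M \<Longrightarrow> \<omega> \<in> cylinder (digit_word (\<lambda>i. A i \<omega>) n)"
  using digit_ge_1[of \<omega>] by (auto simp: cylinder_def digit_word_def Suc_le_eq)

lemma cylinder_append_subset: "cylinder (w @ u) \<subseteq> cylinder w"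
  by (force simp: cylinder_def nth_append)

lemma disjoint_cylinders: "disjoint_family_on (\<lambda>u. cylinder (w @ u)) {u. length u = n}"
  unfolding disjoint_family_on_def
proof (intro ballI impI)
  fix u v :: "nat list" assume uv: "u \<in> {u. length u = n}" "v \<in> {u. length u = n}" "u \<noteq> v"
  then obtain i where i: "i < n" "u ! i \<noteq> v ! i"
    by (metis (mono_tags, lifting) mem_Collect_eq nth_equalityI)
  have digit: "A (Suc (length w + i)) \<omega> = Suc (x ! i)" if "\<omega> \<in> cylinder (w @ x)" "length x = n" for \<omega> x
  proof -
    have "length w + i < length (w @ x)" using that(2) i(1) by simp
    with that(1) have "A (Suc (length w + i)) \<omega> = Suc ((w @ x) ! (length w + i))"
      unfolding cylinder_def by blast
    then show ?thesis by simp
  qed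
  have "\<omega> \<notin> cylinder (w @ v)" if "\<omega> \<in> cylinder (w @ u)" for \<omega>
    using digit[OF that] digit[of \<omega> v] i(2) uv by auto
  then show "cylinder (w @ u) \<inter> cylinder (w @ v) = {}" by blast
qed

lemma word_sum_prob_cylinder:
  "word_sum n (\<lambda>u. ennreal (prob (cylinder (w @ u)))) \<le> ennreal (prob (cylinder w))"
proof -
  have "word_sum n (\<lambda>u. ennreal (prob (cylinder (w @ u))))
      = emeasure M (\<Union>u\<in>{u. length u = n}. cylinder (w @ u))"
    unfolding word_sum_def emeasure_eq_measure[symmetric]
    by (rule emeasure_UN_countable[symmetric]) (auto intro: disjoint_cylinders countable_subset)
  also have "\<dots> \<le> emeasure M (cylinder w)"
    using cylinder_append_subset by (intro emeasure_mono) auto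
  finally show ?thesis by (simp add: emeasure_eq_measure)
qed

text \<open>
  The Markov property as a product formula, which remains true for cylinders of probability \<open>0\<close>.
\<close>

lemma markov_cylinder_step:
  assumes "markov_chain_of_order k M A" "k \<le> length v"
  shows "prob (cylinder (v @ [j])) = prob (cylinder v) *
    \<P>(\<omega> in M. A (length v + 1) \<omega> = Suc j \<bar> \<forall>i\<in>{length v + 1 - k..length v}. A i \<omega> = Suc (v ! (i - 1)))"
proof -
  let ?n = "length v"
  let ?a = "\<lambda>i. Suc (v ! (i - 1))"
  have past: "{\<omega> \<in> space M. \<forall>i\<in>{1..?n}. A i \<omega> = ?a i} = cylinder v"
  proof -
    have "(\<forall>i\<in>{1..?n}. A i \<omega> = ?a i) \<longleftrightarrow> (\<forall>i<?n. A (Suc i) \<omega> = Suc (v ! i))" for \<omega>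
      using ball_atLeast1_atMost[of ?n "\<lambda>i. A i \<omega> = ?a i"] by simp
    then show ?thesis by (auto simp: cylinder_def)
  qed
  have joint: "{\<omega> \<in> space M. A (?n + 1) \<omega> = Suc j \<and> (\<forall>i\<in>{1..?n}. A i \<omega> = ?a i)} = cylinder (v @ [j])"
  proof -
    have "{\<omega> \<in> space M. A (?n + 1) \<omega> = Suc j \<and> (\<forall>i\<in>{1..?n}. A i \<omega> = ?a i)}
        = {\<omega> \<in> cylinder v. A (Suc ?n) \<omega> = Suc j}"
      unfolding past[symmetric] by auto
    also have "\<dots> = cylinder (v @ [j])"
      by (auto simp: cylinder_def nth_append less_Suc_eq)
    finally show ?thesis .
  qed
  show ?thesis
  proof (cases "0 < prob (cylinder v)")
    case True
    then have "\<P>(\<omega> in M. A (?n + 1) \<omega> = Suc j \<bar> \<forall>i\<in>{1..?n}. A i \<omega> = ?a i) =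
        \<P>(\<omega> in M. A (?n + 1) \<omega> = Suc j \<bar> \<forall>i\<in>{?n + 1 - k..?n}. A i \<omega> = ?a i)"
      using assms(1)[unfolded markov_chain_of_order_def, rule_format, OF assms(2), of ?a "Suc j"]
      unfolding past by simp
    moreover have "\<P>(\<omega> in M. A (?n + 1) \<omega> = Suc j \<bar> \<forall>i\<in>{1..?n}. A i \<omega> = ?a i)
        = prob (cylinder (v @ [j])) / prob (cylinder v)"
      unfolding cond_prob_def past joint ..
    ultimately show ?thesis using True by (simp add: field_simps)
  next
    case False
    then have "prob (cylinder v) = 0" by (simp add: zero_less_measure_iff)
    moreover have "prob (cylinder (v @ [j])) \<le> prob (cylinder v)"
      by (intro finite_measure_mono cylinder_append_subset) auto
    ultimately show ?thesis by (simp add: measure_le_0_iff)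
  qed
qed

text \<open>
  The first letter of a probe word has left the window of \<open>k\<close> digits when its last letter is drawn,
  so the conditional probability \<open>\<beta> j\<close> of the latter does not involve \<open>i\<close>.
\<close>

lemma prob_probe_factorizes:
  assumes "markov_chain_of_order k M A"
  obtains \<beta> where
    "\<And>i j. prob (cylinder (w @ probe_word k i j)) = prob (cylinder (w @ i # replicate k 0)) * \<beta> j"
proof
  define n where "n = length w + k + 1"
  fix i j
  let ?v = "w @ i # replicate k 0"
  have len: "length ?v = n" by (simp add: n_def)
  have "?v ! (l - 1) = 0" if "l \<in> {n + 1 - k..n}" for l
  proof -
    from that have "length w + 2 \<le> l" by (simp add: n_def)
    then obtain m where "l = length w + 2 + m" by (metis le_Suc_ex)
    moreover from this have "m < k" using that by (simp add: n_def)
    ultimately show ?thesis by (simp add: nth_append)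
  qed
  then have window: "(\<forall>l\<in>{n + 1 - k..n}. A l \<omega> = Suc (?v ! (l - 1))) \<longleftrightarrow> (\<forall>l\<in>{n + 1 - k..n}. A l \<omega> = 1)" for \<omega>
    by simp
  have "prob (cylinder (?v @ [j])) = prob (cylinder ?v) *
      \<P>(\<omega> in M. A (n + 1) \<omega> = Suc j \<bar> \<forall>l\<in>{n + 1 - k..n}. A l \<omega> = 1)"
    using markov_cylinder_step[OF assms, of ?v j] unfolding len window by (simp add: n_def)
  then show "prob (cylinder (w @ probe_word k i j)) = prob (cylinder ?v) *
      \<P>(\<omega> in M. A (n + 1) \<omega> = Suc j \<bar> \<forall>l\<in>{n + 1 - k..n}. A l \<omega> = 1)"
    by (simp add: probe_word_def)
qed

text \<open>
  The bound for one block, applied to the conditional law \<open>\<kappa>\<close> of the next block given the word \<open>w\<close>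
  and to the parameter \<open>t\<close> that \<open>w\<close> leaves behind.
\<close>

lemma affinity_block_step:
  assumes markov: "markov_chain_of_order k M A" and r: "1 / 4 \<le> r" "r \<le> 1"
    and len: "\<And>t. 0 \<le> t \<Longrightarrow> t \<le> 1 \<Longrightarrow>
      word_sum (k + 2) (\<lambda>u. ennreal (cyl_length t u powr (2 * r))) \<le> ennreal (1 + (gap k)\<^sup>2 / 8)"
  shows "word_sum (k + 2) (\<lambda>u. ennreal (cyl_length 0 (w @ u) powr r * sqrt (prob (cylinder (w @ u)))))
    \<le> ennreal (cyl_length 0 w powr r * sqrt (prob (cylinder w))) * ennreal (1 - (gap k)\<^sup>2 / 16)"
proof (cases "prob (cylinder w) = 0")
  case True
  then have "prob (cylinder (w @ u)) = 0" for u
    using finite_measure_mono[OF cylinder_append_subset[of w u]] by (simp add: measure_le_0_iff)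
  then show ?thesis by (simp add: word_sum_def)
next
  case False
  define q where "q = prob (cylinder w)"
  have q: "0 < q" using False by (simp add: q_def zero_less_measure_iff)
  define \<kappa> where "\<kappa> u = prob (cylinder (w @ u)) / q" for u
  define t where "t = cyl_param 0 w"
  have t: "0 \<le> t" "t \<le> 1" unfolding t_def using cyl_param_bounds[of 0 w] by auto
  obtain \<beta> where "\<And>i j. prob (cylinder (w @ probe_word k i j)) = prob (cylinder (w @ i # replicate k 0)) * \<beta> j"
    using prob_probe_factorizes[OF markov] by metis
  then have rank1: "\<kappa> (probe_word k 0 0) * \<kappa> (probe_word k 1 1) = \<kappa> (probe_word k 0 1) * \<kappa> (probe_word k 1 0)"
    by (simp add: \<kappa>_def)
  have "word_sum (k + 2) (\<lambda>u. ennreal (\<kappa> u))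
      = ennreal (1 / q) * word_sum (k + 2) (\<lambda>u. ennreal (prob (cylinder (w @ u))))"
    unfolding word_sum_cmult[symmetric] using q
    by (intro word_sum_cong) (simp add: \<kappa>_def ennreal_mult[symmetric])
  also have "\<dots> \<le> ennreal (1 / q) * ennreal q"
    unfolding q_def by (intro mult_left_mono word_sum_prob_cylinder) auto
  also have "\<dots> = 1" using q by (simp add: ennreal_mult[symmetric])
  finally have \<kappa>: "word_sum (k + 2) (\<lambda>u. ennreal (\<kappa> u)) \<le> 1" .
  have "word_sum (k + 2) (\<lambda>u. ennreal (cyl_length 0 (w @ u) powr r * sqrt (prob (cylinder (w @ u)))))
      = ennreal (cyl_length 0 w powr r * sqrt q) *
        word_sum (k + 2) (\<lambda>u. ennreal (cyl_length t u powr r * sqrt (\<kappa> u)))"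
    unfolding word_sum_cmult[symmetric]
  proof (rule word_sum_cong)
    fix u
    have "cyl_length 0 (w @ u) powr r * sqrt (prob (cylinder (w @ u)))
        = (cyl_length 0 w powr r * sqrt q) * (cyl_length t u powr r * sqrt (\<kappa> u))"
      using q cyl_length_pos[of 0 w] cyl_length_pos[OF t(1), of u]
      by (simp add: cyl_length_append t_def[symmetric] powr_mult \<kappa>_def real_sqrt_divide)
    then show "ennreal (cyl_length 0 (w @ u) powr r * sqrt (prob (cylinder (w @ u))))
        = ennreal (cyl_length 0 w powr r * sqrt q) * ennreal (cyl_length t u powr r * sqrt (\<kappa> u))"
      using q by (simp add: ennreal_mult[symmetric] \<kappa>_def)
  qed
  also have "\<dots> \<le> ennreal (cyl_length 0 w powr r * sqrt q) * ennreal (1 - (gap k)\<^sup>2 / 16)"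
    using block_affinity_bound[OF t r _ \<kappa> rank1 len[OF t]] q
    by (intro mult_left_mono) (auto simp: \<kappa>_def)
  finally show ?thesis by (simp add: q_def)
qed

lemma affinity_decay:
  assumes markov: "markov_chain_of_order k M A" and r: "1 / 4 \<le> r" "r \<le> 1"
    and len: "\<And>t. 0 \<le> t \<Longrightarrow> t \<le> 1 \<Longrightarrow>
      word_sum (k + 2) (\<lambda>u. ennreal (cyl_length t u powr (2 * r))) \<le> ennreal (1 + (gap k)\<^sup>2 / 8)"
  shows "word_sum (n * (k + 2)) (\<lambda>w. ennreal (cyl_length 0 w powr r * sqrt (prob (cylinder w))))
    \<le> ennreal (1 - (gap k)\<^sup>2 / 16) ^ n"
proof (induction n)
  case 0
  have "prob (cylinder []) \<le> 1" by simp
  then show ?case by (simp add: word_sum_0)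
next
  case (Suc n)
  let ?f = "\<lambda>w. ennreal (cyl_length 0 w powr r * sqrt (prob (cylinder w)))"
  have "word_sum (Suc n * (k + 2)) ?f = word_sum (n * (k + 2)) (\<lambda>w. word_sum (k + 2) (\<lambda>u. ?f (w @ u)))"
    unfolding mult_Suc add.commute[of "k + 2"] by (rule word_sum_append)
  also have "\<dots> \<le> word_sum (n * (k + 2)) (\<lambda>w. ennreal (1 - (gap k)\<^sup>2 / 16) * ?f w)"
    by (intro word_sum_mono) (subst mult.commute, rule affinity_block_step[OF markov r len])
  also have "\<dots> \<le> ennreal (1 - (gap k)\<^sup>2 / 16) * ennreal (1 - (gap k)\<^sup>2 / 16) ^ n"
    unfolding word_sum_cmult by (intro mult_left_mono Suc.IH) auto
  finally show ?case by simp
qed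

lemma continued_fraction_measurable:
  "(\<lambda>\<omega>. continued_fraction (\<lambda>n. A n \<omega>)) \<in> measurable M (restrict_space borel unit_irrationals)"
proof (rule measurable_restrict_space2)
  show "(\<lambda>\<omega>. continued_fraction (\<lambda>n. A n \<omega>)) \<in> space M \<rightarrow> unit_irrationals"
    using continued_fraction_limit(2) digit_ge_1 by auto
  have approx: "(\<lambda>\<omega>. cf_approximant n (\<lambda>i. A (i + m) \<omega>)) \<in> borel_measurable M" for n m
  proof (induction n arbitrary: m)
    case (Suc n)
    have "(\<lambda>\<omega>. real (A (Suc m) \<omega>)) \<in> borel_measurable M" by measurable
    moreover have "(\<lambda>\<omega>. cf_approximant n (\<lambda>i. A (Suc (i + m)) \<omega>)) \<in> borel_measurable M"
      using Suc[of "Suc m"] by simp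
    ultimately show ?case by simp
  qed simp
  show "(\<lambda>\<omega>. continued_fraction (\<lambda>n. A n \<omega>)) \<in> borel_measurable M"
  proof (rule borel_measurable_LIMSEQ_real)
    show "(\<lambda>n. cf_approximant n (\<lambda>i. A i \<omega>)) \<longlonglongrightarrow> continued_fraction (\<lambda>i. A i \<omega>)" if "\<omega> \<in> space M" for \<omega>
      using continued_fraction_limit(1)[OF digit_ge_1[OF that]] .
    show "(\<lambda>\<omega>. cf_approximant n (\<lambda>i. A i \<omega>)) \<in> borel_measurable M" for n
      using approx[of n 0] by simp
  qed
qed

text \<open>
  Put \<open>y w = |w|\<^sup>r\<close>, let \<open>q w\<close> be the probability of the cylinder of \<open>w\<close>, and let \<open>\<sigma>\<^sup>2\<close> be the
  factor gained per block, so that the sum of \<open>y w \<cdot> \<surd>(q w)\<close> over words of \<open>n\<close> blocks is at most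
  \<open>\<sigma>\<^bsup>2n\<^esup>\<close>. Call such a word good if \<open>y w \<le> \<sigma>\<^sup>n \<surd>(q w)\<close>. Then the good words are cheap, since their
  \<open>2 r\<close>-dimensional cost is at most the sum of \<open>\<sigma>\<^bsup>2n\<^esup> q w\<close>; the bad words are improbable, since for
  them \<open>q w \<le> \<sigma>\<^bsup>-n\<^esup> y w \<surd>(q w)\<close>, which sums to at most \<open>\<sigma>\<^sup>n\<close>. Almost surely all but finitely many
  prefixes are therefore good, and the points lying in infinitely many good cylinders form a set of
  \<open>2 r\<close>-dimensional Hausdorff measure \<open>0\<close>.
\<close>

theorem dimension_le:
  assumes markov: "markov_chain_of_order k M A" and r: "1 / 4 \<le> r" "r \<le> 1"
    and len: "\<And>t. 0 \<le> t \<Longrightarrow> t \<le> 1 \<Longrightarrow>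
      word_sum (k + 2) (\<lambda>u. ennreal (cyl_length t u powr (2 * r))) \<le> ennreal (1 + (gap k)\<^sup>2 / 8)"
  shows "measure_hausdorff_dim (cf_distribution M A) \<le> ereal (2 * r)"
proof -
  define L where "L = k + 2"
  have "0 < L" by (simp add: L_def)
  define \<sigma> where "\<sigma> = sqrt (1 - (gap k)\<^sup>2 / 16)"
  have "gap k \<le> 1"
    unfolding gap_def by (intro mult_le_one power_le_one) auto
  then have "(gap k)\<^sup>2 \<le> 1" using gap_pos[of k] by (intro power_le_one) auto
  then have \<sigma>: "0 < \<sigma>" "\<sigma> < 1" "\<sigma>\<^sup>2 = 1 - (gap k)\<^sup>2 / 16" "\<sigma>\<^sup>2 < 1"
    using gap_pos[of k] by (auto simp: \<sigma>_def)
  define q where "q w = prob (cylinder w)" for w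
  define y where "y w = cyl_length 0 w powr r" for w
  define good where "good n = {w. length w = n * L \<and> y w \<le> \<sigma> ^ n * sqrt (q w)}" for n
  define bad where "bad n = {w. length w = n * L \<and> \<sigma> ^ n * sqrt (q w) < y w}" for n
  have y0: "0 \<le> y w" and q0: "0 \<le> q w" for w by (auto simp: y_def q_def)
  have decay: "word_sum (n * L) (\<lambda>w. ennreal (y w * sqrt (q w))) \<le> ennreal (\<sigma> ^ (2 * n))" for n
  proof -
    have "ennreal (1 - (gap k)\<^sup>2 / 16) ^ n = ennreal (\<sigma> ^ (2 * n))"
      unfolding \<sigma>(3)[symmetric] power_mult by (simp add: ennreal_power)
    then show ?thesis
      using affinity_decay[OF markov r len, of n] by (simp only: L_def y_def q_def)
  qed

  \<comment> \<open>The good cylinders have a convergent total cost.\<close>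
  have good_sum: "word_sum (n * L) (\<lambda>w. ennreal ((y w)\<^sup>2) * indicator (good n) w) \<le> ennreal ((\<sigma>\<^sup>2) ^ n)" for n
  proof -
    have "word_sum (n * L) (\<lambda>w. ennreal ((y w)\<^sup>2) * indicator (good n) w)
        \<le> word_sum (n * L) (\<lambda>w. ennreal ((\<sigma>\<^sup>2) ^ n) * ennreal (q w))"
    proof (rule word_sum_mono)
      fix w
      have "(y w)\<^sup>2 \<le> (\<sigma>\<^sup>2) ^ n * q w" if "w \<in> good n"
        using that power_mono[of "y w" "\<sigma> ^ n * sqrt (q w)" 2] y0 q0
        by (simp add: good_def power_mult_distrib power_mult[symmetric] mult.commute)
      then show "ennreal ((y w)\<^sup>2) * indicator (good n) w \<le> ennreal ((\<sigma>\<^sup>2) ^ n) * ennreal (q w)"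
        using q0 by (auto simp: ennreal_mult[symmetric] ennreal_leI split: split_indicator)
    qed
    also have "\<dots> \<le> ennreal ((\<sigma>\<^sup>2) ^ n) * 1"
      unfolding word_sum_cmult
    proof (rule mult_left_mono)
      have "word_sum (n * L) (\<lambda>w. ennreal (q w)) \<le> ennreal (prob (cylinder []))"
        using word_sum_prob_cylinder[of "n * L" "[]"] by (simp add: q_def)
      also have "\<dots> \<le> 1" by simp
      finally show "word_sum (n * L) (\<lambda>w. ennreal (q w)) \<le> 1" .
    qed simp
    finally show ?thesis by simp
  qed
  define U where "U i = (if list_decode i \<in> (\<Union>n. good n) then cf_interval (list_decode i) else {})" for i
  define E where "E = {x \<in> unit_irrationals. \<exists>\<^sub>\<infinity>i. x \<in> U i}"
  have "(\<Sum>i. ennreal (diameter (U i) powr (2 * r)))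
      \<le> (\<Sum>i. \<Sum>n. ennreal ((y (list_decode i))\<^sup>2) * indicator (good n) (list_decode i))"
  proof (rule suminf_le)
    fix i
    let ?w = "list_decode i"
    show "ennreal (diameter (U i) powr (2 * r)) \<le> (\<Sum>n. ennreal ((y ?w)\<^sup>2) * indicator (good n) ?w)"
    proof (cases "?w \<in> (\<Union>n. good n)")
      case True
      then obtain n where n: "?w \<in> good n" by blast
      have "diameter (U i) powr (2 * r) \<le> cyl_length 0 ?w powr (2 * r)"
        using True diameter_cf_interval_le r
        by (intro powr_mono2) (auto simp: U_def diameter_ge_0 compact_cf_interval compact_imp_bounded)
      also have "\<dots> = (y ?w)\<^sup>2"
        by (simp add: y_def power2_eq_square powr_add[symmetric])
      finally have "ennreal (diameter (U i) powr (2 * r)) \<le> ennreal ((y ?w)\<^sup>2)"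
        by (rule ennreal_leI)
      also have "\<dots> = (\<Sum>m\<in>{n}. ennreal ((y ?w)\<^sup>2) * indicator (good m) ?w)"
        using n by simp
      also have "\<dots> \<le> (\<Sum>m. ennreal ((y ?w)\<^sup>2) * indicator (good m) ?w)"
        by (rule sum_le_suminf) auto
      finally show ?thesis .
    qed (auto simp: U_def)
  qed auto
  also have "\<dots> = (\<integral>\<^sup>+w. (\<Sum>n. ennreal ((y w)\<^sup>2) * indicator (good n) w) \<partial>count_space UNIV)"
    by (rule suminf_list_decode)
  also have "\<dots> = (\<Sum>n. \<integral>\<^sup>+w. ennreal ((y w)\<^sup>2) * indicator (good n) w \<partial>count_space UNIV)"
    by (rule nn_integral_suminf) simp
  also have "\<dots> = (\<Sum>n. word_sum (n * L) (\<lambda>w. ennreal ((y w)\<^sup>2) * indicator (good n) w))"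
  proof (rule suminf_cong)
    fix n
    have "w \<notin> good n" if "length w \<noteq> n * L" for w
      using that by (simp add: good_def)
    then show "(\<integral>\<^sup>+w. ennreal ((y w)\<^sup>2) * indicator (good n) w \<partial>count_space UNIV)
        = word_sum (n * L) (\<lambda>w. ennreal ((y w)\<^sup>2) * indicator (good n) w)"
      unfolding word_sum_def by (intro nn_integral_count_space_eq) simp_all
  qed
  also have "\<dots> \<le> (\<Sum>n. ennreal ((\<sigma>\<^sup>2) ^ n))"
    by (rule suminf_le[OF good_sum]) simp_all
  also have "\<dots> = ennreal (\<Sum>n. (\<sigma>\<^sup>2) ^ n)"
    using \<sigma>(4) by (intro suminf_ennreal2 summable_geometric) simp_all
  finally have fin: "(\<Sum>i. ennreal (diameter (U i) powr (2 * r))) \<noteq> \<top>"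
    by (auto simp: top_unique)
  have bounded_U: "bounded (U i)" for i
    by (simp add: U_def compact_imp_bounded compact_cf_interval)
  have "hausdorff_measure (2 * r) E = 0"
    by (rule hausdorff_measure_limsup_eq_0[OF _ bounded_U fin]) (use r in \<open>auto simp: E_def\<close>)
  then have dimE: "hausdorff_dim E \<le> ereal (2 * r)"
    unfolding hausdorff_dim_def using r by (intro Inf_lower) auto

  \<comment> \<open>The probabilities of the bad words are summable.\<close>
  define B where "B n = (\<Union>w\<in>bad n. cylinder w)" for n
  have countable: "countable S" for S :: "nat list set" by (rule countable_subset[OF subset_UNIV]) auto
  have B_sets [measurable]: "B n \<in> sets M" for n
    unfolding B_def using countable by (intro sets.countable_UN') auto
  have B_prob: "prob (B n) \<le> \<sigma> ^ n" for n
  proof -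
    have "emeasure M (B n) \<le> (\<integral>\<^sup>+w. emeasure M (cylinder w) \<partial>count_space (bad n))"
    proof -
      have "disjoint_family_on cylinder (bad n)"
        using disjoint_cylinders[of "[]" "n * L"] by (auto simp: disjoint_family_on_def bad_def)
      then show ?thesis
        unfolding B_def using countable by (subst emeasure_UN_countable) auto
    qed
    also have "\<dots> \<le> word_sum (n * L) (\<lambda>w. ennreal (inverse (\<sigma> ^ n)) * ennreal (y w * sqrt (q w)))"
    proof -
      have "q w \<le> inverse (\<sigma> ^ n) * (y w * sqrt (q w))" if "w \<in> bad n" for w
      proof -
        have "q w = inverse (\<sigma> ^ n) * ((\<sigma> ^ n * sqrt (q w)) * sqrt (q w))"
          using \<sigma>(1) q0[of w] by (simp add: mult.assoc)
        also have "\<dots> \<le> inverse (\<sigma> ^ n) * (y w * sqrt (q w))"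
          using that \<sigma>(1) q0[of w]
          by (intro mult_left_mono[OF mult_right_mono]) (simp_all add: bad_def less_imp_le)
        finally show ?thesis .
      qed
      then have "(\<integral>\<^sup>+w. emeasure M (cylinder w) \<partial>count_space (bad n))
        \<le> (\<integral>\<^sup>+w. ennreal (inverse (\<sigma> ^ n)) * ennreal (y w * sqrt (q w)) \<partial>count_space (bad n))"
        unfolding emeasure_eq_measure q_def[symmetric]
        using \<sigma>(1) y0 q0 by (intro nn_integral_mono) (simp add: ennreal_mult[symmetric] ennreal_leI)
      also have "\<dots> \<le> word_sum (n * L) (\<lambda>w. ennreal (inverse (\<sigma> ^ n)) * ennreal (y w * sqrt (q w)))"
        unfolding word_sum_def
        by (subst (1 2) nn_integral_count_space_indicator)
          (auto intro!: nn_integral_mono simp: bad_def split: split_indicator)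
      finally show ?thesis .
    qed
    also have "\<dots> \<le> ennreal (inverse (\<sigma> ^ n)) * ennreal (\<sigma> ^ (2 * n))"
      unfolding word_sum_cmult by (intro mult_left_mono decay) auto
    also have "\<dots> = ennreal (\<sigma> ^ n)"
      using \<sigma>(1) by (simp add: ennreal_mult[symmetric] mult_2 power_add)
    finally show ?thesis using \<sigma>(1) by (simp add: emeasure_eq_measure)
  qed
  have "summable (\<lambda>n. prob (B n))"
    using \<sigma>(1,2) B_prob by (intro summable_comparison_test'[OF summable_geometric[of \<sigma>]]) simp_all
  then have AE_good: "AE \<omega> in M. eventually (\<lambda>n. \<omega> \<in> space M - B n) sequentially"
    by (intro borel_cantelli_AE1) (auto simp: emeasure_eq_measure)
  \<comment> \<open>Prefixes of different lengths have different codes, so a point meets infinitely many \<open>U i\<close>.\<close>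
  have infinitely_often: "continued_fraction (\<lambda>n. A n \<omega>) \<in> E"
    if \<omega>: "\<omega> \<in> space M" and ev: "eventually (\<lambda>n. \<omega> \<in> space M - B n) sequentially" for \<omega>
  proof -
    let ?a = "\<lambda>n. A n \<omega>"
    let ?w = "\<lambda>n. digit_word ?a (n * L)"
    note a = digit_ge_1[OF \<omega>]
    obtain N where N: "\<And>n. N \<le> n \<Longrightarrow> \<omega> \<notin> B n"
      using ev unfolding eventually_sequentially by blast
    have "continued_fraction ?a \<in> U (list_encode (?w n))" if "N \<le> n" for n
    proof -
      have "?w n \<notin> bad n"
        using N[OF that] in_cylinder_digit_word[OF \<omega>, of "n * L"] by (auto simp: B_def)
      then have "?w n \<in> good n" by (auto simp: bad_def good_def)
      then show ?thesis
        using continued_fraction_in_cf_interval[OF a] by (auto simp: U_def)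
    qed
    then have "(\<lambda>n. list_encode (?w n)) ` {N..} \<subseteq> {i. continued_fraction ?a \<in> U i}" by auto
    moreover have "infinite ((\<lambda>n. list_encode (?w n)) ` {N..})"
    proof
      assume "finite ((\<lambda>n. list_encode (?w n)) ` {N..})"
      moreover have "inj_on (\<lambda>n. list_encode (?w n)) {N..}"
      proof (rule inj_onI)
        fix m n assume "list_encode (?w m) = list_encode (?w n)"
        then have "length (?w m) = length (?w n)" by (metis list_encode_inverse)
        then show "m = n" using \<open>0 < L\<close> by simp
      qed
      ultimately have "finite {N..}" by (rule finite_imageD)
      then show False using infinite_Ici by blast
    qed
    ultimately have "\<exists>\<^sub>\<infinity>i. continued_fraction ?a \<in> U i"
      unfolding INFM_iff_infinite using finite_subset by blast
    then show ?thesis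
      using continued_fraction_limit(2)[OF a] by (simp add: E_def)
  qed
  have AE_E: "AE \<omega> in M. continued_fraction (\<lambda>n. A n \<omega>) \<in> E"
    using AE_good by (rule AE_mp) (simp add: infinitely_often)
  have E_sets: "E \<in> sets (restrict_space borel unit_irrationals)"
  proof -
    have U_borel: "U i \<in> sets borel" for i
      by (auto simp: U_def compact_imp_closed compact_cf_interval)
    have "E = unit_irrationals \<inter> (\<Inter>m. \<Union>i\<in>{m..}. U i)"
      unfolding E_def INFM_nat_le by blast
    moreover have "(\<Inter>m. \<Union>i\<in>{m..}. U i) \<in> sets borel"
      using U_borel by (intro sets.countable_INT sets.countable_UN) auto
    ultimately show ?thesis by (auto simp: sets_restrict_space)
  qed
  have "emeasure (cf_distribution M A) E = 1"
    unfolding cf_distribution_def emeasure_distr[OF continued_fraction_measurable E_sets]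
    using measurable_sets[OF continued_fraction_measurable E_sets] AE_E
    by (intro emeasure_eq_1_AE) auto
  then have "measure_hausdorff_dim (cf_distribution M A) \<le> hausdorff_dim E"
    unfolding measure_hausdorff_dim_def
    using E_sets by (intro Inf_lower) (auto simp: cf_distribution_def)
  then show ?thesis using dimE by (rule order_trans)
qed

end

section \<open>Choice of the constant\<close>

text \<open>
  As \<open>c\<close> tends to \<open>0\<close>, the bound \<open>(1 + 4 c K)\<^bsup>k + 2\<^esup>\<close> for a block of \<open>k + 2\<close> digits tends to \<open>1\<close>, hence
  drops below the slack that the affinity estimate tolerates. Only \<open>k\<close> enters this choice.
\<close>

lemma gap_exponent_exists:
  "\<exists>c>0. c < 1 / 4 \<and> (\<forall>t\<in>{0..1}.
     word_sum (k + 2) (\<lambda>u. ennreal (cyl_length t u powr (1 - c))) \<le> ennreal (1 + (gap k)\<^sup>2 / 8))"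
proof -
  obtain K where K: "\<forall>t\<in>{0..1}. (\<Sum>d. ennreal (digit_prob t d powr (3/4))) \<le> ennreal K" "1 \<le> K"
    using digit_prob_powr_sum_bound by blast
  have "((\<lambda>c. (1 + 4 * c * K) ^ (k + 2)) \<longlongrightarrow> (1 + 4 * 0 * K) ^ (k + 2)) (at_right 0)"
    by (intro tendsto_intros)
  then have "\<forall>\<^sub>F c in at_right 0. (1 + 4 * c * K) ^ (k + 2) < 1 + (gap k)\<^sup>2 / 8"
    using gap_pos[of k] by (intro order_tendstoD) auto
  moreover have "\<forall>\<^sub>F c in at_right 0. 0 < c \<and> c < (1 / 4 :: real)"
    by (rule eventually_at_rightI[of 0 "1 / 4"]) auto
  ultimately have "\<forall>\<^sub>F c in at_right 0. (1 + 4 * c * K) ^ (k + 2) < 1 + (gap k)\<^sup>2 / 8 \<and> 0 < c \<and> c < 1 / 4"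
    by (rule eventually_conj)
  then obtain c where c: "(1 + 4 * c * K) ^ (k + 2) < 1 + (gap k)\<^sup>2 / 8" "0 < c" "c < 1 / 4"
    using eventually_happens'[OF trivial_limit_at_right_real] by blast
  have "word_sum (k + 2) (\<lambda>u. ennreal (cyl_length t u powr (1 - c))) \<le> ennreal (1 + (gap k)\<^sup>2 / 8)"
    if "t \<in> {0..1}" for t
  proof -
    have "word_sum (k + 2) (\<lambda>u. ennreal (cyl_length t u powr (1 - c))) \<le> ennreal ((1 + 4 * c * K) ^ (k + 2))"
      using that c by (intro word_sum_cyl_length_powr K) auto
    also have "\<dots> \<le> ennreal (1 + (gap k)\<^sup>2 / 8)"
      using c(1) by (intro ennreal_leI) simp
    finally show ?thesis .
  qed
  then show ?thesis using c by blast
qed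

section \<open>Transfer to the space of digit sequences\<close>

text \<open>
  All data of the problem depend only on the joint law of the digits. Replacing a digit process by
  the coordinate process under its law on \<^typ>\<open>nat \<Rightarrow> nat\<close> therefore makes a constant that is valid
  on this one sample space valid on all others.
\<close>

lemma cf_approximant_cong:
  "(\<And>i. 1 \<le> i \<Longrightarrow> a i = b i) \<Longrightarrow> cf_approximant n a = cf_approximant n b"
proof (induction n arbitrary: a b)
  case (Suc n)
  then have "cf_approximant n (\<lambda>i. a (Suc i)) = cf_approximant n (\<lambda>i. b (Suc i))"
    by (intro Suc.IH) auto
  then show ?case using Suc.prems[of 1] by simp
qed simp

lemma continued_fraction_cong:
  assumes "\<And>i. 1 \<le> i \<Longrightarrow> a i = b i"
  shows "continued_fraction a = continued_fraction b"
  using cf_approximant_cong[of a b, OF assms] by (simp add: continued_fraction_def)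

context digit_process
begin

text \<open>
  The value at \<open>0\<close> is replaced by a constant, because \<open>A 0\<close> may fail to be measurable or positive.
\<close>

definition digit_path :: "'a \<Rightarrow> nat \<Rightarrow> nat" where
  "digit_path \<omega> n = (if n = 0 then 1 else A n \<omega>)"

definition path_law :: "(nat \<Rightarrow> nat) measure" where
  "path_law = distr M (PiM UNIV (\<lambda>_. count_space {1..})) digit_path"

abbreviation coordinate :: "nat \<Rightarrow> (nat \<Rightarrow> nat) \<Rightarrow> nat" where
  "coordinate \<equiv> \<lambda>n f. f n"

lemma digit_path_measurable: "digit_path \<in> measurable M (PiM UNIV (\<lambda>_. count_space {1..}))"
proof -
  have "(\<lambda>\<omega> n. digit_path \<omega> n) \<in> measurable M (PiM UNIV (\<lambda>_. count_space {1..}))"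
  proof (rule measurable_PiM_single')
    show "(\<lambda>\<omega>. digit_path \<omega> n) \<in> measurable M (count_space {1..})" for n
      using digit_measurable[of n] by (cases n) (simp_all add: digit_path_def)
    show "(\<lambda>\<omega> n. digit_path \<omega> n) \<in> space M \<rightarrow> (\<Pi>\<^sub>E i\<in>UNIV. space (count_space {1..}))"
      using digit_ge_1 by (auto simp: digit_path_def)
  qed
  then show ?thesis by simp
qed

lemma digit_process_path_law: "digit_process path_law coordinate"
proof -
  interpret L: prob_space path_law
    unfolding path_law_def by (rule prob_space_distr[OF digit_path_measurable])
  show ?thesis
  proof
    fix n :: nat
    show "coordinate n \<in> measurable path_law (count_space {1..})"
      unfolding path_law_def measurable_distr_eq1
      by (rule measurable_component_singleton) simp
  qed
qed

lemma measure_path_law: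
  "E \<in> sets path_law \<Longrightarrow> measure path_law E = measure M (digit_path -` E \<inter> space M)"
  unfolding path_law_def by (subst measure_distr[OF digit_path_measurable]) auto

lemma digit_path_in_space: "\<omega> \<in> space M \<Longrightarrow> digit_path \<omega> \<in> space path_law"
  using measurable_space[OF digit_path_measurable] by (simp add: path_law_def)

lemma prob_path_law_event:
  assumes "finite I" "I \<subseteq> {1..}"
  shows "\<P>(f in path_law. \<forall>i\<in>I. f i = a i) = \<P>(\<omega> in M. \<forall>i\<in>I. A i \<omega> = a i)"
proof -
  interpret L: digit_process path_law coordinate by (rule digit_process_path_law)
  have "{f \<in> space path_law. f i = a i} \<in> sets path_law" if "i \<in> I" for i
  proof -
    have "1 \<le> i" using assms(2) that by auto
    then obtain j where "i = Suc j" by (cases i) auto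
    then have "coordinate i -` {a i} \<inter> space path_law \<in> sets path_law"
      using measurable_sets[OF L.digit_measurable_UNIV[of j], of "{a i}"] by simp
    then show ?thesis by (simp add: vimage_def Int_def conj_commute)
  qed
  then have "{f \<in> space path_law. \<forall>i\<in>I. f i = a i} \<in> sets path_law"
    using assms(1) by (intro sets.sets_Collect_finite_All) auto
  then have "\<P>(f in path_law. \<forall>i\<in>I. f i = a i)
      = prob (digit_path -` {f \<in> space path_law. \<forall>i\<in>I. f i = a i} \<inter> space M)"
    by (rule measure_path_law)
  also have "digit_path -` {f \<in> space path_law. \<forall>i\<in>I. f i = a i} \<inter> space M = {\<omega> \<in> space M. \<forall>i\<in>I. A i \<omega> = a i}"
  proof -
    have "(\<forall>i\<in>I. digit_path \<omega> i = a i) \<longleftrightarrow> (\<forall>i\<in>I. A i \<omega> = a i)" for \<omega>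
      using assms(2) by (intro ball_cong) (auto simp: digit_path_def)
    then show ?thesis by (auto simp: digit_path_in_space)
  qed
  finally show ?thesis .
qed

lemma cond_prob_path_law:
  assumes "finite I" "I \<subseteq> {1..}" "j \<notin> I" "1 \<le> j"
  shows "\<P>(f in path_law. f j = b \<bar> \<forall>i\<in>I. f i = a i) = \<P>(\<omega> in M. A j \<omega> = b \<bar> \<forall>i\<in>I. A i \<omega> = a i)"
proof -
  have joint: "(x j = b \<and> (\<forall>i\<in>I. x i = a i)) \<longleftrightarrow> (\<forall>i\<in>insert j I. x i = (a(j := b)) i)" for x :: "nat \<Rightarrow> nat"
    using assms(3) by auto
  have "\<P>(f in path_law. f j = b \<and> (\<forall>i\<in>I. f i = a i)) = \<P>(\<omega> in M. A j \<omega> = b \<and> (\<forall>i\<in>I. A i \<omega> = a i))"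
    using prob_path_law_event[of "insert j I" "a(j := b)"] assms
    unfolding joint[of "\<lambda>i. A i _"] joint by simp
  then show ?thesis
    using prob_path_law_event[OF assms(1,2)] by (simp add: cond_prob_def)
qed

lemma markov_path_law:
  assumes "markov_chain_of_order k M A"
  shows "markov_chain_of_order k path_law coordinate"
  unfolding markov_chain_of_order_def
proof (intro allI impI)
  fix n b and a :: "nat \<Rightarrow> nat"
  assume n: "k \<le> n" and pos: "0 < \<P>(f in path_law. \<forall>i\<in>{1..n}. f i = a i)"
  have "0 < \<P>(\<omega> in M. \<forall>i\<in>{1..n}. A i \<omega> = a i)"
    using pos prob_path_law_event[of "{1..n}" a] by simp
  note assms[unfolded markov_chain_of_order_def, rule_format, OF n this, of b]
  moreover have "\<P>(f in path_law. f (n + 1) = b \<bar> \<forall>i\<in>{1..n}. f i = a i)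
      = \<P>(\<omega> in M. A (n + 1) \<omega> = b \<bar> \<forall>i\<in>{1..n}. A i \<omega> = a i)"
    by (rule cond_prob_path_law) auto
  moreover have "\<P>(f in path_law. f (n + 1) = b \<bar> \<forall>i\<in>{n + 1 - k..n}. f i = a i)
      = \<P>(\<omega> in M. A (n + 1) \<omega> = b \<bar> \<forall>i\<in>{n + 1 - k..n}. A i \<omega> = a i)"
    using n by (intro cond_prob_path_law) auto
  ultimately show "\<P>(f in path_law. f (n + 1) = b \<bar> \<forall>i\<in>{1..n}. f i = a i)
      = \<P>(f in path_law. f (n + 1) = b \<bar> \<forall>i\<in>{n + 1 - k..n}. f i = a i)"
    by simp
qed

lemma generated_sigma_path_law:
  assumes "I \<subseteq> {1..}" "E \<in> generated_sigma path_law coordinate I"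
  shows "E \<in> sets path_law \<and> digit_path -` E \<inter> space M \<in> generated_sigma M A I"
  using assms(2) unfolding generated_sigma_def
proof (induction rule: sigma_sets.induct)
  case (Basic E)
  then obtain i B where i: "i \<in> I" "E = coordinate i -` B \<inter> space path_law" by auto
  interpret L: digit_process path_law coordinate by (rule digit_process_path_law)
  have "1 \<le> i" using assms(1) i(1) by auto
  then obtain j where "i = Suc j" by (cases i) auto
  then have "E \<in> sets path_law"
    unfolding i(2) using measurable_sets[OF L.digit_measurable_UNIV[of j], of B] by simp
  moreover have "digit_path -` E \<inter> space M = A i -` B \<inter> space M"
    unfolding i(2) using \<open>i = Suc j\<close> by (auto simp: digit_path_in_space digit_path_def)
  ultimately show ?case using i(1) by (auto intro!: sigma_sets.Basic)
next
  case (Compl E)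
  have "digit_path -` (space path_law - E) \<inter> space M = space M - (digit_path -` E \<inter> space M)"
    by (auto simp: digit_path_in_space)
  with Compl show ?case by (auto intro!: sigma_sets.Compl)
next
  case (Union E)
  have "digit_path -` (\<Union>i. E i) \<inter> space M = (\<Union>i. digit_path -` E i \<inter> space M)" by auto
  then show ?case
    using Union.IH by (auto simp only: intro!: sigma_sets.Union sets.countable_UN)
qed (simp_all add: sigma_sets.Empty)

lemma star_mixing_path_law:
  assumes "star_mixing M A"
  shows "star_mixing path_law coordinate"
proof -
  from assms obtain N g where Ng: "1 \<le> N" "antimono_on {N..} g" "g \<longlonglongrightarrow> 0"
    and mix: "\<And>n m E F. \<lbrakk>N \<le> n; 1 \<le> m; E \<in> generated_sigma M A {1..m}; F \<in> generated_sigma M A {m + n..}\<rbrakk>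
      \<Longrightarrow> \<bar>measure M (E \<inter> F) - measure M E * measure M F\<bar> \<le> g n * measure M E * measure M F"
    unfolding star_mixing_def by blast
  have "\<bar>measure path_law (E \<inter> F) - measure path_law E * measure path_law F\<bar>
      \<le> g n * measure path_law E * measure path_law F"
    if nm: "N \<le> n" "1 \<le> m" and E: "E \<in> generated_sigma path_law coordinate {1..m}"
      and F: "F \<in> generated_sigma path_law coordinate {m + n..}" for n m E F
  proof -
    have E': "E \<in> sets path_law" "digit_path -` E \<inter> space M \<in> generated_sigma M A {1..m}"
      using generated_sigma_path_law[OF _ E] by auto
    have F': "F \<in> sets path_law" "digit_path -` F \<inter> space M \<in> generated_sigma M A {m + n..}"
      using generated_sigma_path_law[OF _ F] nm by auto
    have "digit_path -` (E \<inter> F) \<inter> space M = (digit_path -` E \<inter> space M) \<inter> (digit_path -` F \<inter> space M)" by auto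
    then show ?thesis
      using mix[OF nm E'(2) F'(2)] E'(1) F'(1) by (simp add: measure_path_law)
  qed
  then show ?thesis using Ng unfolding star_mixing_def by blast
qed

lemma cf_distribution_path_law: "cf_distribution path_law coordinate = cf_distribution M A"
proof -
  interpret L: digit_process path_law coordinate by (rule digit_process_path_law)
  have meas: "(\<lambda>f. continued_fraction (\<lambda>n. f n)) \<in> measurable (PiM UNIV (\<lambda>_. count_space {1..}))
      (restrict_space borel unit_irrationals)"
    using L.continued_fraction_measurable by (simp add: path_law_def)
  have "continued_fraction (digit_path \<omega>) = continued_fraction (\<lambda>n. A n \<omega>)" for \<omega>
    by (rule continued_fraction_cong) (simp add: digit_path_def)
  then show ?thesis
    unfolding cf_distribution_def path_law_def distr_distr[OF meas digit_path_measurable]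
    by (simp add: comp_def)
qed

end

theorem theorem2p3:
  fixes k :: nat
  shows
    "(\<exists>c :: real. 0 < c \<and> c < 1 \<and>
        (\<forall>(M :: (nat \<Rightarrow> nat) measure) A.
           prob_space M \<and> (\<forall>n\<ge>1. A n \<in> measurable M (count_space {1..})) \<and>
           markov_chain_of_order k M A \<and> star_mixing M A \<longrightarrow>
           measure_hausdorff_dim (cf_distribution M A) \<le> ereal (1 - c))) \<and>
     (\<forall>c :: real. 0 < c \<and> c < 1 \<and>
        (\<forall>(M :: (nat \<Rightarrow> nat) measure) A.
           prob_space M \<and> (\<forall>n\<ge>1. A n \<in> measurable M (count_space {1..})) \<and>
           markov_chain_of_order k M A \<and> star_mixing M A \<longrightarrow>
           measure_hausdorff_dim (cf_distribution M A) \<le> ereal (1 - c)) \<longrightarrow>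
        (\<forall>(M :: 'a measure) A.
           prob_space M \<and> (\<forall>n\<ge>1. A n \<in> measurable M (count_space {1..})) \<and>
           markov_chain_of_order k M A \<and> star_mixing M A \<longrightarrow>
           measure_hausdorff_dim (cf_distribution M A) \<le> ereal (1 - c)))"
proof (intro conjI allI impI)
  obtain c where c: "0 < c" "c < 1 / 4" and len: "\<And>t. t \<in> {0..1} \<Longrightarrow>
     word_sum (k + 2) (\<lambda>u. ennreal (cyl_length t u powr (1 - c))) \<le> ennreal (1 + (gap k)\<^sup>2 / 8)"
    using gap_exponent_exists[of k] by blast
  have "measure_hausdorff_dim (cf_distribution M A) \<le> ereal (1 - c)"
    if "prob_space M" "\<forall>n\<ge>1. A n \<in> measurable M (count_space {1..})" "markov_chain_of_order k M A"
    for M :: "(nat \<Rightarrow> nat) measure" and A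
  proof -
    interpret digit_process M A
      using that by (simp add: digit_process_def digit_process_axioms_def)
    have half: "2 * ((1 - c) / 2) = 1 - c" by simp
    have "measure_hausdorff_dim (cf_distribution M A) \<le> ereal (2 * ((1 - c) / 2))"
      by (rule dimension_le[OF that(3)]) (unfold half, use c len in simp_all)
    then show ?thesis unfolding half .
  qed
  then show "\<exists>c :: real. 0 < c \<and> c < 1 \<and>
        (\<forall>(M :: (nat \<Rightarrow> nat) measure) A.
           prob_space M \<and> (\<forall>n\<ge>1. A n \<in> measurable M (count_space {1..})) \<and>
           markov_chain_of_order k M A \<and> star_mixing M A \<longrightarrow>
           measure_hausdorff_dim (cf_distribution M A) \<le> ereal (1 - c))"
    using c by (intro exI[of _ c]) auto
next
  fix c :: real and M :: "'a measure" and A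
  assume c: "0 < c \<and> c < 1 \<and>
        (\<forall>(M :: (nat \<Rightarrow> nat) measure) A.
           prob_space M \<and> (\<forall>n\<ge>1. A n \<in> measurable M (count_space {1..})) \<and>
           markov_chain_of_order k M A \<and> star_mixing M A \<longrightarrow>
           measure_hausdorff_dim (cf_distribution M A) \<le> ereal (1 - c))"
    and MA: "prob_space M \<and> (\<forall>n\<ge>1. A n \<in> measurable M (count_space {1..})) \<and>
           markov_chain_of_order k M A \<and> star_mixing M A"
  interpret digit_process M A
    using MA by (simp add: digit_process_def digit_process_axioms_def)
  interpret L: digit_process path_law coordinate by (rule digit_process_path_law)
  have "measure_hausdorff_dim (cf_distribution path_law coordinate) \<le> ereal (1 - c)"
  proof (rule c[THEN conjunct2, THEN conjunct2, rule_format], intro conjI allI impI)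
    show "prob_space path_law" by (rule L.prob_space_axioms)
    show "coordinate n \<in> measurable path_law (count_space {1..})" if "1 \<le> n" for n
      using that by (rule L.digit_measurable)
    show "markov_chain_of_order k path_law coordinate" using MA markov_path_law by blast
    show "star_mixing path_law coordinate" using MA star_mixing_path_law by blast
  qed
  then show "measure_hausdorff_dim (cf_distribution M A) \<le> ereal (1 - c)"
    by (simp add: cf_distribution_path_law)
qed

end
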